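(* Let $b\geqslant2$ be an integer, let $\lambda\in(\lambda_b,1)$, and let $\gamma=\frac{1}{b\lambda}$, with $\lambda_b$ and the functions $\Theta_z:[0,1)^2\to\mathbb{R}$ as defined in the context. For each $\eta>0$ there are $\delta\in(0,\eta)$ and $C>0$ such that for each $r\in(0,1)$ there is a measurable set $E_r\subset[0,1)^2$ with $m^2(E_r)\leqslant C r^\delta$ and the following property: for each $z\in[-1,1]\setminus\{0\}$ and for each measurable family $(L_x)_{x\in[0,1)}$ of intervals $L_x\subset\mathbb{R}$ of length $\frac{2r}{|z|}$, $$m^2\{(\xi,x)\in[0,1)^2\setminus E_r:\ \Theta_z(\xi,x)\in L_x\}\leqslant C\,r^{1-2\eta}\,|z|^{-(1-\eta)}.$$
   Context: $m^2$ denotes two-dimensional Lebesgue measure on $[0,1)^2$. A measurable family of intervals $(L_x)_{x\in[0,1)}$ is one whose endpoints depend measurably on $x$. The number $\lambda_b$ is the unique zero on the interval $(1/b,1)$ of the function $$h_b(\lambda)=\begin{cases}\frac{1}{4\lambda^2(2\lambda-1)^2}+\frac{1}{16\lambda^2(4\lambda-1)^2}-\frac{5}{64\lambda^2}+\frac{\sqrt2}{2\lambda}-1&\text{for }b=2,\\ \frac{1}{(b\lambda-1)^2}+\frac{1}{(b^2\lambda-1)^2}-\sin^2\left(\frac{\pi}{b}\right)&\text{for }b\geqslant3.\end{cases}$$ Let $\tau:[0,1)\to[0,1)$, $\tau(\xi)=b\xi\bmod 1$, and let $k(\xi)=j\in\{0,\dots,b-1\}$ if $\xi\in[j/b,(j+1)/b)$.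 For $(\xi,x)\in[0,1)^2$ and $n\geqslant0$ put $\xi_n=\tau^n(\xi)$ and $$x_n=\frac{x}{b^n}+\frac{k(\xi_0)}{b^n}+\frac{k(\xi_1)}{b^{n-1}}+\dots+\frac{k(\xi_{n-1})}{b},$$ so that $(\xi_n,x_n)=B^n(\xi,x)$ for the $b$-baker map $B(\xi,x)=\left(\tau(\xi),\frac{x+k(\xi)}{b}\right)$. Let $s(t)=(t/2)^{-1}\sin(2\pi t/2)$ for $t\neq0$ and $s(0)=2\pi$ (the continuous extension). For $z\in[-1,1]$ define $$\Theta_z(\xi,x)=\sum_{n=1}^\infty\gamma^n\,s\left(\frac{z}{b^n}\right)\sin\left(2\pi\left(x_n+\frac{z}{2b^n}\right)\right).$$
   Formalization: The range "each η>0" is restricted to 0<η≤1: for η>1 the claim is false, since Θ_z is bounded uniformly in z, so L_x=[-r/|z|,r/|z|] contains all its values for small |z|, while the right-hand side tends to 0 as z→0. *)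

theory Defs
  imports "HOL-Analysis.Analysis"
begin

definition h_fun :: "nat \<Rightarrow> real \<Rightarrow> real" where
  "h_fun b l =
    (if b = 2 then
       1 / (4 * l^2 * (2 * l - 1)^2) + 1 / (16 * l^2 * (4 * l - 1)^2)
         - 5 / (64 * l^2) + sqrt 2 / (2 * l) - 1
     else
       1 / (real b * l - 1)^2 + 1 / ((real b)^2 * l - 1)^2 - (sin (pi / real b))^2)"

definition lambda_b :: "nat \<Rightarrow> real" where
  "lambda_b b = (THE l. 1 / real b < l \<and> l < 1 \<and> h_fun b l = 0)"

definition tau :: "nat \<Rightarrow> real \<Rightarrow> real" where
  "tau b \<xi> = frac (real b * \<xi>)"

text \<open>For \<open>\<xi> \<in> [0,1)\<close> this is the \<open>j\<close> with \<open>\<xi> \<in> [j/b, (j+1)/b)\<close>.\<close>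

definition digit :: "nat \<Rightarrow> real \<Rightarrow> nat" where
  "digit b \<xi> = nat \<lfloor>real b * \<xi>\<rfloor>"

definition xi_seq :: "nat \<Rightarrow> real \<Rightarrow> nat \<Rightarrow> real" where
  "xi_seq b \<xi> n = (tau b ^^ n) \<xi>"

definition x_seq :: "nat \<Rightarrow> real \<Rightarrow> real \<Rightarrow> nat \<Rightarrow> real" where
  "x_seq b \<xi> x n =
     x / real b ^ n + (\<Sum>i<n. real (digit b (xi_seq b \<xi> i)) / real b ^ (n - i))"

definition baker :: "nat \<Rightarrow> real \<times> real \<Rightarrow> real \<times> real" where
  "baker b = (\<lambda>(\<xi>, x). (tau b \<xi>, (x + real (digit b \<xi>)) / real b))"

lemma baker_iterate: "(baker b ^^ n) (\<xi>, x) = (xi_seq b \<xi> n, x_seq b \<xi> x n)"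
proof (induction n)
  case 0
  show ?case by (simp add: xi_seq_def x_seq_def)
next
  case (Suc n)
  have "(\<Sum>i<n. real (digit b (xi_seq b \<xi> i)) / real b ^ (Suc n - i))
      = (\<Sum>i<n. real (digit b (xi_seq b \<xi> i)) / real b ^ (n - i)) / real b"
    unfolding sum_divide_distrib by (rule sum.cong) (simp_all add: Suc_diff_le mult.commute)
  then show ?case
    using Suc by (simp add: baker_def xi_seq_def x_seq_def add_divide_distrib mult.commute)
qed

definition s_fun :: "real \<Rightarrow> real" where
  "s_fun t = (if t = 0 then 2 * pi else sin (2 * pi * t / 2) / (t / 2))"

text \<open>The series starts at \<open>n = 1\<close>, hence the shift to \<open>Suc n\<close>.\<close>

definition Theta :: "nat \<Rightarrow> real \<Rightarrow> real \<Rightarrow> real \<times> real \<Rightarrow> real" where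
  "Theta b \<gamma> z = (\<lambda>(\<xi>, x).
     \<Sum>n. \<gamma> ^ Suc n * s_fun (z / real b ^ Suc n)
        * sin (2 * pi * (x_seq b \<xi> x (Suc n) + z / (2 * real b ^ Suc n))))"

text \<open>
  Each \<open>L x\<close> may contain both, one or none of its endpoints, and this may vary
  with \<open>x\<close>; only the endpoints are required to be (Lebesgue) measurable.
\<close>

definition measurable_interval_family :: "(real \<Rightarrow> real set) \<Rightarrow> bool" where
  "measurable_interval_family L \<longleftrightarrow>
     (\<forall>x\<in>{0..<1}. is_interval (L x) \<and> bounded (L x) \<and> L x \<noteq> {}) \<and>
     (\<lambda>x. Inf (L x)) \<in> borel_measurable (lebesgue_on {0..<1}) \<and>
     (\<lambda>x. Sup (L x)) \<in> borel_measurable (lebesgue_on {0..<1})"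

definition interval_length :: "real set \<Rightarrow> real" where
  "interval_length I = Sup I - Inf I"

definition unit_square :: "(real \<times> real) set" where
  "unit_square = {0..<1} \<times> {0..<1}"

end

(*
  For fixed x, the number Theta_z(xi,x) is a sum over the random digits of xi.  Truncated after m
  digits and at z = 0 it is wave m (x + u), where u < b^m encodes the digits.  The condition
  lambda_b < lam guarantees transversality: if u and u' differ in their first digit,
  then x |-> wave m (x + u) - wave m (x + u') and its derivative are never simultaneously small.
  Hence such a difference is at most rho on a set of measure O(rho), and summing over the position
  of the first differing digit (a geometric series of ratio lam) the set of triples (x,u,u') with
  |wave m (x + u) - wave m (x + u')| <= c gamma^m has probability O(gamma^m).  By Markov's
  inequality, except for (x,u) in a set of measure O(gamma^(m eta)), at most
  b^m gamma^(m (1 - eta)) words u' have a value within c gamma^m of that of u.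

  Choose m with gamma^m of size r^(eta/2), and let E consist of the points whose orbit under the
  baker map is exceptional in this sense at time m i for some i >= 1 up to a bound depending on eta.  If Theta_z(xi,x)
  lies in a prescribed interval of length 2r/|z|, then at each time m i with i >= 1, given the
  previous digits, the next block of m digits has wave value in an interval of length O(gamma^m):
  replacing z / b^(m i) by 0 costs only O(b^-m) <= O(gamma^m).  Off E each block therefore admits at most
  b^m gamma^(m (1 - eta)) words.  Multiplying over all blocks, until gamma^(m i) reaches r/|z|,
  gives (r/|z|)^(1 - eta) up to a factor gamma^(-2m), that is, O(r^-eta).
*)

theory Submission imports Defs begin

section \<open>The threshold\<close>

text \<open>The set \<open>E\<close> must serve every \<open>z\<close> and every family of intervals
  at once, so it is built from the limiting sums at \<open>z = 0\<close> alone. Transversality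
  controls close pairs of words only on average over the base point and the words, whereas the count
  along an orbit needs a bound at every block; sparsity of the current word is the pointwise
  substitute, and \<open>E\<close> pays for the words that lack it. Blocks must be so long that
  \<open>\<gamma> ^ m\<close> is comparable to a power of \<open>r\<close>, for this price to be a
  power of \<open>r\<close>; their number is then bounded in terms of \<eta> alone, so the union
  over times costs a constant. The form of \<open>h_fun\<close> comes from comparing two vectors:
  the normalised difference of two words together with its derivative, at the levels kept exactly,
  against geometric series for the remaining levels. One level is kept for \<open>b \<ge> 3\<close>,
  where the main vector has squared length at least \<open>(sin (pi / b))^2\<close>; two are kept
  for \<open>b = 2\<close>, which yields the longer formula.\<close>

lemma inverse_mult_power2_strict_antimono:
  fixes c d l l' :: real
  assumes "0 < c" "1 < d * l" "0 < l" "0 < d" "l < l'"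
  shows "1 / (c * l'^2 * (d * l' - 1)^2) < 1 / (c * l^2 * (d * l - 1)^2)"
proof -
  have 1: "d * l < d * l'" using assms by simp
  have "l^2 * (d * l - 1)^2 < l'^2 * (d * l' - 1)^2"
    by (rule mult_strict_mono) (use assms 1 in \<open>auto intro!: power_strict_mono\<close>)
  then show ?thesis
    using assms(1-3,5) \<open>1 < d * l\<close> order.strict_trans[OF \<open>1 < d * l\<close> 1]
    by (intro divide_strict_left_mono mult_pos_pos) (simp_all add: mult.assoc)
qed

lemma inverse_power2_strict_antimono:
  fixes d l l' :: real
  assumes "1 < d * l" "0 < d" "l < l'"
  shows "1 / (d * l' - 1)^2 < 1 / (d * l - 1)^2"
proof -
  have 1: "d * l < d * l'" using assms by simp
  show ?thesis
    using assms(1) order.strict_trans[OF \<open>1 < d * l\<close> 1] 1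
    by (intro divide_strict_left_mono power_strict_mono mult_pos_pos) simp_all
qed

text \<open>For \<open>b = 2\<close> the terms \<open>- 5 / (64 * l^2)\<close> and
  \<open>sqrt 2 / (2 * l)\<close> compete. In the variable \<open>1 / l\<close> they form a concave
  quadratic that still increases on the whole range \<open>1 / l < 2\<close>.\<close>

lemma h_fun_strict_antimono:
  assumes b: "b \<ge> 2" and l: "1 / real b < l" "l < l'" "l' \<le> 1"
  shows "h_fun b l' < h_fun b l"
proof (cases "b = 2")
  case True
  have l2: "1/2 < l" using l True by simp
  define u where "u = 1 / l"
  define v where "v = 1 / l'"
  have uv: "v < u" "u < 2" "v < 2"
    using l l2 by (auto simp: u_def v_def field_simps)
  have "0 < (u - v) * (sqrt 2 / 2 - 5 * (u + v) / 64)"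
  proof (rule mult_pos_pos)
    have "5 * (u + v) / 64 < 1 / 2" using uv by simp
    also have "1 / 2 \<le> sqrt 2 / 2" by (intro divide_right_mono) simp_all
    finally show "0 < sqrt 2 / 2 - 5 * (u + v) / 64" by (simp only: diff_gt_0_iff_gt)
  qed (use uv in simp)
  then have 3: "- (5 * v^2 / 64) + sqrt 2 / 2 * v < - (5 * u^2 / 64) + sqrt 2 / 2 * u"
    by (simp add: field_simps power2_eq_square)
  have 1: "1 / (4 * l'^2 * (2 * l' - 1)^2) < 1 / (4 * l^2 * (2 * l - 1)^2)"
    using l l2 by (intro inverse_mult_power2_strict_antimono) auto
  have 2: "1 / (16 * l'^2 * (4 * l' - 1)^2) < 1 / (16 * l^2 * (4 * l - 1)^2)"
    using l l2 by (intro inverse_mult_power2_strict_antimono) auto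
  show ?thesis
    using 1 2 3 True by (simp add: h_fun_def u_def v_def power_divide)
next
  case False
  have bl: "1 < real b * l" using l b by (simp add: field_simps)
  have bb: "real b \<le> (real b)^2" using b by (simp add: power2_eq_square)
  have "l > 0" using l by (smt (verit) divide_nonneg_nonneg of_nat_0_le_iff)
  then have bbl: "1 < (real b)^2 * l"
    using bl bb by (smt (verit) mult_right_mono)
  show ?thesis
    using inverse_power2_strict_antimono[OF bl _ l(2)] inverse_power2_strict_antimono[OF bbl _ l(2)]
      False b by (simp add: h_fun_def)
qed

lemma h_fun_neg_at_1:
  assumes b: "b \<ge> 2"
  shows "h_fun b 1 < 0"
proof (cases "b = 2")
  case True
  have "sqrt 2 < 3 / 2" by (rule real_less_lsqrt) (auto simp: power2_eq_square)
  then show ?thesis using True by (simp add: h_fun_def)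
next
  case False
  define B where "B = real b"
  have B: "3 \<le> B" using False b by (simp add: B_def)
  \<comment> \<open>The margin is small: the two fractions are bounded by about
    \<open>2.39 / B^2\<close>, while \<open>(1.57 / B)^2\<close> is about \<open>2.46 / B^2\<close>,
    so \<open>3 < pi\<close> would be too crude here.\<close>
  have p3: "3.14 < pi" using pi_approx by simp
  have "pi / B \<le> pi / 3" using B by (intro divide_left_mono) auto
  have "\<exists>z. 0 < z \<and> z < pi / B \<and> sin (pi / B) - sin 0 = (pi / B - 0) * cos z"
    using B by (intro MVT2) (auto intro!: derivative_eq_intros)
  then obtain z where z: "0 < z" "z < pi / B" "sin (pi / B) = (pi / B) * cos z" by auto
  have "cos (pi / 3) \<le> cos z"
    using z(1) order.strict_trans2[OF z(2) \<open>pi / B \<le> pi / 3\<close>] pi_gt_zero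
    by (intro cos_monotone_0_pi_le) simp_all
  then have "1 / 2 \<le> cos z" by (simp add: cos_60)
  then have "pi / B * (1 / 2) \<le> sin (pi / B)"
    unfolding z(3) using B by (intro mult_left_mono) auto
  moreover have "3.14 / B * (1/2) \<le> pi / B * (1 / 2)"
    using p3 B by (intro mult_right_mono divide_right_mono) auto
  ultimately have "1.57 / B \<le> sin (pi / B)" by simp
  then have 0: "(1.57 / B)^2 \<le> (sin (pi / B))^2"
    using B by (intro power_mono) auto
  have "2 * B / 3 \<le> B - 1" using B by simp
  then have "(2 * B / 3)^2 \<le> (B - 1)^2" using B by (intro power_mono) auto
  then have 1: "1 / (B - 1)^2 \<le> 1 / (2 * B / 3)^2" using B
    by (intro divide_left_mono) (auto intro!: mult_pos_pos)
  have "3 * B \<le> B * B" using B by (intro mult_right_mono) auto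
  then have "8 * B / 3 \<le> B^2 - 1" using B unfolding power2_eq_square by linarith
  then have "(8 * B / 3)^2 \<le> (B^2 - 1)^2" using B by (intro power_mono) auto
  then have 2: "1 / (B^2 - 1)^2 \<le> 1 / (8 * B / 3)^2"
    using B \<open>8 * B / 3 \<le> B^2 - 1\<close> by (intro divide_left_mono) (auto intro!: mult_pos_pos)
  have "1 / (2 * B / 3)^2 + 1 / (8 * B / 3)^2 < (1.57 / B)^2"
    using B by (simp add: field_simps power2_eq_square)
  with 0 1 2 have "1 / (B - 1)^2 + 1 / (B^2 - 1)^2 - (sin (pi / B))^2 < 0" by linarith
  then show ?thesis using False b by (simp add: h_fun_def B_def)
qed

lemma h_fun_zero:
  assumes b: "b \<ge> 2"
  shows "\<exists>l. 1 / real b < l \<and> l < 1 \<and> h_fun b l = 0"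
proof -
  \<comment> \<open>At \<open>2 / b\<close> one has \<open>b * l - 1 = 1\<close>, and the first
    fraction alone dominates the squared sine. For \<open>b = 2\<close> this point would be the
    right end point \<open>1\<close>, where the sign is already negative; hence
    \<open>3 / 4\<close>.\<close>
  define l0 :: real where "l0 = (if b = 2 then 3/4 else 2 / real b)"
  have l0: "1 / real b < l0" "l0 < 1" using b by (auto simp: l0_def field_simps)
  have "0 < h_fun b l0"
  proof (cases "b = 2")
    case True
    have "1 \<le> sqrt 2" by simp
    moreover have "0 < 2 / 3 + sqrt 2 * 2 / 3" by (simp add: add_pos_pos)
    ultimately show ?thesis using True by (simp add: l0_def h_fun_def power2_eq_square)
  next
    case False
    have "(sin (pi / real b))^2 \<le> 1" by (simp add: abs_square_le_1)
    moreover have "0 < 2 * real b - 1" using b by linarith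
    then have "0 < 1 / (2 * real b - 1)^2" by simp
    moreover have "real b * l0 = 2" "(real b)^2 * l0 = 2 * real b"
      using b by (auto simp: l0_def False power2_eq_square)
    moreover have "h_fun b l0 = 1 + 1 / (2 * real b - 1)^2 - (sin (pi / real b))^2"
      using False \<open>real b * l0 = 2\<close> \<open>(real b)^2 * l0 = 2 * real b\<close> by (simp add: h_fun_def)
    ultimately show ?thesis by linarith
  qed
  have "\<forall>x. l0 \<le> x \<and> x \<le> 1 \<longrightarrow> isCont (h_fun b) x"
  proof safe
    fix x assume x: "l0 \<le> x" "x \<le> 1"
    have bx: "1 < real b * x" using l0 x b by (auto simp: field_simps intro: less_le_trans)
    have "1 / real b > 0" using b by simp
    then have "x > 0" using l0 x by linarith
    have "1 * (real b * x) \<le> real b * (real b * x)"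
      using b \<open>x > 0\<close> by (intro mult_right_mono) auto
    then have bbx: "1 < (real b)^2 * x" using bx by (simp add: power2_eq_square mult.assoc)
    show "isCont (h_fun b) x"
    proof (cases "b = 2")
      case True
      then have "h_fun b = (\<lambda>l. 1 / (4 * l^2 * (2 * l - 1)^2) + 1 / (16 * l^2 * (4 * l - 1)^2)
         - 5 / (64 * l^2) + sqrt 2 / (2 * l) - 1)" by (auto simp: h_fun_def)
      then show ?thesis using \<open>x > 0\<close> bx bbx True by (auto intro!: continuous_intros)
    next
      case False
      then have "h_fun b = (\<lambda>l. 1 / (real b * l - 1)^2 + 1 / ((real b)^2 * l - 1)^2
        - (sin (pi / real b))^2)" by (auto simp: h_fun_def)
      then show ?thesis using bx bbx by (auto intro!: continuous_intros)
    qed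
  qed
  then obtain x where "l0 \<le> x" "x \<le> 1" "h_fun b x = 0"
    using IVT2[of "h_fun b" 1 0 l0] l0 \<open>0 < h_fun b l0\<close> h_fun_neg_at_1[OF b] by auto
  moreover have "x \<noteq> 1" using \<open>h_fun b x = 0\<close> h_fun_neg_at_1[OF b] by auto
  ultimately show ?thesis using l0 by (intro exI[of _ x]) auto
qed

text \<open>Strict decrease and the existing zero give meaning to the \<open>THE\<close> in
  \<open>lambda_b\<close>. The hypothesis \<open>lambda_b b < lam\<close> acts later through these
  two facts: the first means \<open>\<gamma> < 1\<close>, the second is the strict inequality behind
  transversality.\<close>

lemma h_fun_neg_above_lambda_b:
  assumes b: "b \<ge> 2" and l: "lambda_b b < l" "l < 1"
  shows "1 / real b < l" "h_fun b l < 0"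
proof -
  have "\<exists>!l. 1 / real b < l \<and> l < 1 \<and> h_fun b l = 0"
  proof (rule ex_ex1I[OF h_fun_zero[OF b]])
    fix l l' assume "1 / real b < l \<and> l < 1 \<and> h_fun b l = 0" "1 / real b < l' \<and> l' < 1 \<and> h_fun b l' = 0"
    then show "l = l'"
      using h_fun_strict_antimono[OF b, of l l'] h_fun_strict_antimono[OF b, of l' l] by force
  qed
  then have *: "1 / real b < lambda_b b \<and> lambda_b b < 1 \<and> h_fun b (lambda_b b) = 0"
    unfolding lambda_b_def by (rule theI')
  then show "1 / real b < l" using l by simp
  show "h_fun b l < 0" using h_fun_strict_antimono[OF b, of "lambda_b b" l] * l by auto
qed

section \<open>Transversality\<close>

lemma sum_power_interval_le:
  fixes q :: real
  assumes "0 \<le> q" "q < 1"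
  shows "(\<Sum>n=k..<m. q ^ n) \<le> q ^ k / (1 - q)"
proof (cases "k \<le> m")
  case True
  then have "(1 - q) * (\<Sum>n=k..<m. q ^ n) = q ^ k - q ^ m"
  proof (induction m rule: dec_induct)
    case (step n)
    have "(1 - q) * (\<Sum>n=k..<Suc n. q ^ n) = (1 - q) * (\<Sum>n=k..<n. q ^ n) + (1 - q) * q ^ n"
      using step by (simp add: distrib_left)
    also have "\<dots> = q ^ k - q ^ Suc n" unfolding step.IH by (simp add: algebra_simps)
    finally show ?case .
  qed simp
  then have "(\<Sum>n=k..<m. q ^ n) = (q ^ k - q ^ m) / (1 - q)"
    using assms by (simp add: eq_divide_eq mult.commute)
  also have "\<dots> \<le> q ^ k / (1 - q)" using assms by (intro divide_right_mono) auto
  finally show ?thesis .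
qed (use assms in auto)

lemma sum_lessThan_diff_le:
  fixes f :: "nat \<Rightarrow> real"
  assumes q: "0 \<le> q" "q < 1" and "k \<le> m" and f: "\<And>n. \<bar>f n\<bar> \<le> q ^ n"
  shows "\<bar>(\<Sum>n<m. f n) - (\<Sum>n<k. f n)\<bar> \<le> q ^ k / (1 - q)"
proof -
  have "(\<Sum>n<m. f n) - (\<Sum>n<k. f n) = (\<Sum>n=k..<m. f n)"
    using sum_diff_nat_ivl[of 0 k m f] \<open>k \<le> m\<close> by (simp add: lessThan_atLeast0)
  also have "\<bar>\<dots>\<bar> \<le> (\<Sum>n=k..<m. q ^ n)"
    by (rule order.trans[OF sum_abs sum_mono]) (rule f)
  also have "\<dots> \<le> q ^ k / (1 - q)" by (rule sum_power_interval_le[OF q])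
  finally show ?thesis .
qed

text \<open>\<open>(F, F1)\<close> is the main vector, disturbed by at most \<open>r0\<close> and
  \<open>r1\<close> in its coordinates. If both coordinates of the result had size at most
  \<open>e\<close>, then \<open>A \<le> (r0 + e)^2 + (r1 + e)^2\<close>, which fails for small
  \<open>e\<close>. This turns the strict inequality \<open>h_fun b lam < 0\<close> into a gap
  independent of the point and of the words.\<close>

lemma perturbed_pair_bounded_away:
  fixes r0 r1 A :: real
  assumes r: "0 \<le> r0" "0 \<le> r1" and A: "r0^2 + r1^2 < A"
  obtains e where "0 < e"
    "\<And>F F1 P Q. A \<le> F^2 + F1^2 \<Longrightarrow> \<bar>P - F\<bar> \<le> r0 \<Longrightarrow> \<bar>Q - F1\<bar> \<le> r1 \<Longrightarrow> e < \<bar>P\<bar> \<or> e < \<bar>Q\<bar>"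
proof -
  define d where "d = A - (r0^2 + r1^2)"
  \<comment> \<open>For \<open>e \<le> 1\<close> the sum of squares grows by at most
    \<open>e * (2 * (r0 + r1) + 2)\<close>; the \<open>3\<close> makes the final inequality
    strict.\<close>
  define e where "e = min 1 (d / (2 * (r0 + r1) + 3))"
  have d: "d > 0" using A by (simp add: d_def)
  have e: "0 < e" "e \<le> 1" using d r by (auto simp: e_def)
  have "e * (2 * (r0 + r1) + 3) \<le> d / (2 * (r0 + r1) + 3) * (2 * (r0 + r1) + 3)"
    using r by (intro mult_right_mono) (auto simp: e_def)
  also have "\<dots> = d" using r by simp
  finally have "e * (2 * (r0 + r1) + 3) \<le> d" .
  moreover have "e * (2 * (r0 + r1) + 3) = e * (2 * (r0 + r1)) + e * 3" by (simp add: algebra_simps)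
  moreover have "e * (e * 2) \<le> e * 2" using e by (intro mult_left_mono) auto
  moreover have "(r0 + e)^2 + (r1 + e)^2 = r0^2 + r1^2 + e * (2 * (r0 + r1)) + e * (e * 2)"
    by (simp add: power2_eq_square algebra_simps)
  ultimately have *: "(r0 + e)^2 + (r1 + e)^2 < A"
    using e(1) unfolding d_def by linarith
  show ?thesis
  proof (rule that[OF e(1)], rule ccontr)
    fix F F1 P Q :: real
    assume h: "A \<le> F^2 + F1^2" "\<bar>P - F\<bar> \<le> r0" "\<bar>Q - F1\<bar> \<le> r1" "\<not> (e < \<bar>P\<bar> \<or> e < \<bar>Q\<bar>)"
    then have "\<bar>F\<bar> \<le> r0 + e" "\<bar>F1\<bar> \<le> r1 + e" by linarith+
    then have "F^2 \<le> (r0 + e)^2" "F1^2 \<le> (r1 + e)^2"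
      using r e by (auto simp flip: abs_le_square_iff)
    with h(1) * show False by linarith
  qed
qed

lemma sin_pi_div_le_abs_sin:
  fixes d :: int
  assumes b: "b \<ge> 2" and d: "\<not> int b dvd d"
  shows "sin (pi / real b) \<le> \<bar>sin (pi * real_of_int d / real b)\<bar>"
proof -
  define k where "k = d mod int b"
  define q where "q = d div int b"
  have k: "1 \<le> k" "k \<le> int b - 1" 
    using b d pos_mod_bound[of "int b" d] pos_mod_sign[of "int b" d]
    by (auto simp: k_def dvd_eq_mod_eq_0 order.order_iff_strict simp del: pos_mod_bound pos_mod_sign)
  have "d = q * int b + k" by (simp add: q_def k_def)
  then have "real_of_int d = of_int q * real b + of_int k"
    by (metis of_int_add of_int_mult of_int_of_nat_eq)
  then have "pi * real_of_int d / real b = pi * of_int k / real b + pi * of_int q"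
    using b by (simp add: field_simps)
  moreover have "\<bar>sin (y + pi * of_int q)\<bar> = \<bar>sin y\<bar>" for y :: real
    by (simp add: sin_add sin_npi_int cos_npi_int)
  ultimately have 1: "\<bar>sin (pi * real_of_int d / real b)\<bar> = \<bar>sin (pi * of_int k / real b)\<bar>" by simp
  have lower: "- (pi / 2) \<le> pi / real b"
    by (rule order.trans[of _ 0]) auto
  show ?thesis
  proof (cases "2 * k \<le> int b")
    case True
    then have "2 * real_of_int k \<le> real b" by linarith
    then have "sin (pi / real b) \<le> sin (pi * of_int k / real b)"
      using k b by (intro sin_monotone_2pi_le lower) (auto simp: field_simps)
    then show ?thesis using 1 by linarith
  next
    case False
    then have k': "2 * (real b - real_of_int k) \<le> real b" "1 \<le> real b - real_of_int k" "0 \<le> real_of_int k"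
      using k by simp_all
    have "sin (pi / real b) \<le> sin (pi * (real b - of_int k) / real b)"
    proof (intro sin_monotone_2pi_le lower)
      have "pi * 1 \<le> pi * (real b - of_int k)" using k' by (intro mult_left_mono) auto
      then show "pi / real b \<le> pi * (real b - of_int k) / real b"
        using b by (intro divide_right_mono) auto
    qed (use k' b in \<open>auto simp: field_simps\<close>)
    also have "pi * (real b - of_int k) / real b = pi - pi * of_int k / real b"
      using b by (simp add: field_simps)
    also have "sin (pi - pi * of_int k / real b) = sin (pi * of_int k / real b)"
      by simp
    finally show ?thesis using 1 by linarith
  qed
qed

text \<open>
  For \<open>b = 2\<close> and \<open>s, c\<close> the sine and cosine of \<open>pi x / 2\<close>, the two squared terms are the
  contributions of the first two levels to the normalised difference and to its derivative; the
  signs \<open>x, y\<close> encode the second digits.  After expansion, the term linear in \<open>\<gamma>\<close> is at worst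
  \<open>- \<gamma> (c + s)\<^sup>3 / 2\<close>, which is where \<open>sqrt 2\<close> in \<open>h_fun 2\<close> comes from.
\<close>

lemma two_level_bound:
  fixes s c \<gamma> x y :: real
  assumes sc: "s^2 + c^2 = 1" "0 \<le> s" "0 \<le> c" and g: "0 < \<gamma>" "\<gamma> < 1"
    and xy: "x = 1 \<or> x = -1" "y = 1 \<or> y = -1"
  shows "1 - sqrt 2 * \<gamma> + 5 * \<gamma>^2 / 16
    \<le> (2 * s * c + \<gamma> / 2 * (x * s - y * c))^2 + (c^2 - s^2 + \<gamma> / 4 * (x * c + y * s))^2"
    (is "_ \<le> ?F^2 + ?F1^2")
proof -
  have sc': "s * c \<le> 1 / 2" using sc sum_squares_bound[of s c] by simp
  have x2: "x * x = 1" and y2: "y * y = 1" using xy by auto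
  have id: "?F^2 + ?F1^2 = (s^2 + c^2)^2
      + \<gamma> / 2 * (x * c * (c^2 + 3 * s^2) - y * s * (3 * c^2 + s^2))
      + \<gamma>^2 / 4 * ((x * x) * s^2 + (y * y) * c^2) + \<gamma>^2 / 16 * ((x * x) * c^2 + (y * y) * s^2)
      - 3 * \<gamma>^2 / 8 * (x * y) * (s * c)"
    by (simp add: power2_eq_square algebra_simps)
  have id': "?F^2 + ?F1^2 = 1 + \<gamma> / 2 * (x * c * (c^2 + 3 * s^2) - y * s * (3 * c^2 + s^2))
      + 5 * \<gamma>^2 / 16 - 3 * \<gamma>^2 / 8 * (x * y) * (s * c)"
    unfolding id x2 y2 using sc(1) by (simp add: add.commute field_simps)
  have cube: "(c + s)^3 \<le> 2 * sqrt 2"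
  proof -
    have "(c + s)^2 \<le> 2" using sc(1) sc' unfolding power2_sum by (simp add: algebra_simps)
    then have "c + s \<le> sqrt 2" by (rule real_le_rsqrt)
    then have "(c + s)^3 \<le> sqrt 2 ^ 3" using sc by (intro power_mono) auto
    then show ?thesis by (simp add: power3_eq_cube)
  qed
  have s1: "s \<le> 1" and c1: "c \<le> 1" 
    using sc by (smt (verit) power2_le_imp_le one_power2 zero_le_power2)+
  have gg: "\<gamma>^2 \<le> \<gamma>" using g by (simp add: power2_eq_square)
  have gsc: "0 \<le> \<gamma>^2 * (s * c)" "\<gamma>^2 * (s * c) \<le> \<gamma> * (1/2)"
    using sc mult_mono[OF gg sc'] g by simp_all
  have r2: "1 \<le> sqrt 2" by simp
  have lower: "- sqrt 2 * \<gamma> \<le> \<gamma> / 2 * z - w" 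
    if "- (2 * sqrt 2) + 2 * w' \<le> z" "w = \<gamma> * w'" for z w w' :: real
  proof -
    have "\<gamma> / 2 * (- (2 * sqrt 2) + 2 * w') \<le> \<gamma> / 2 * z" using that g by (intro mult_left_mono) auto
    then show ?thesis using that by (simp add: algebra_simps)
  qed
  have "- sqrt 2 * \<gamma> \<le> \<gamma> / 2 * (x * c * (c^2 + 3 * s^2) - y * s * (3 * c^2 + s^2)) 
     - 3 * \<gamma>^2 / 8 * (x * y) * (s * c)"
  proof -
    have pos: "0 \<le> c * (c^2 + 3 * s^2)" "0 \<le> s * (3 * c^2 + s^2)" using sc by auto
    have plus: "c * (c^2 + 3 * s^2) + s * (3 * c^2 + s^2) = (c + s)^3"
      and minus: "c * (c^2 + 3 * s^2) - s * (3 * c^2 + s^2) = (c - s)^3"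
      by (simp_all add: power2_eq_square power3_eq_cube algebra_simps)
    have mb: "\<bar>(c - s)^3\<bar> \<le> 1"
      unfolding power_abs using sc s1 c1 by (intro power_le_one) auto
    have opp: ?thesis if "x * y = -1" "- (2 * sqrt 2) \<le> x * c * (c^2 + 3 * s^2) - y * s * (3 * c^2 + s^2)"
    proof -
      have "- sqrt 2 * \<gamma> \<le> \<gamma> / 2 * (x * c * (c^2 + 3 * s^2) - y * s * (3 * c^2 + s^2)) - 0"
        by (rule lower[where w' = 0]) (use that in auto)
      moreover have "3 * \<gamma>^2 / 8 * (x * y) * (s * c) = - (3 / 8 * (\<gamma>^2 * (s * c)))" using that(1) by simp
      ultimately show ?thesis using gsc by linarith
    qed
    \<comment> \<open>Equal signs make the cross term negative, but of size at most
      \<open>3 / 16 * \<gamma>\<close>, because \<open>\<gamma>^2 \<le> \<gamma>\<close> and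
      \<open>s * c \<le> 1 / 2\<close>. The linear term is then governed by the cube of
      \<open>c - s\<close> instead of \<open>c + s\<close>, which leaves enough room.\<close>
    have same: ?thesis if "x * y = 1" "\<bar>x * c * (c^2 + 3 * s^2) - y * s * (3 * c^2 + s^2)\<bar> \<le> 1"
    proof -
      have "- sqrt 2 * \<gamma> \<le> \<gamma> / 2 * (x * c * (c^2 + 3 * s^2) - y * s * (3 * c^2 + s^2)) - 3 / 16 * \<gamma>"
        by (rule lower[where w' = "3/16"]) (use that r2 in linarith, simp)
      moreover have "3 * \<gamma>^2 / 8 * (x * y) * (s * c) = 3 / 8 * (\<gamma>^2 * (s * c))" using that(1) by simp
      ultimately show ?thesis using gsc by linarith
    qed
    consider "x = 1" "y = 1" | "x = 1" "y = -1" | "x = -1" "y = 1" | "x = -1" "y = -1" using xy by auto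
    then show ?thesis
    proof cases
      case 1 then show ?thesis by (intro same) (use minus mb in auto)
    next
      case 2
      have "- (2 * sqrt 2) \<le> c * (c^2 + 3 * s^2) + s * (3 * c^2 + s^2)"
        by (rule order.trans[of _ 0]) (use pos in auto)
      then show ?thesis by (intro opp) (use 2 in auto)
    next
      case 3 then show ?thesis by (intro opp) (use plus cube in auto)
    next
      case 4 then show ?thesis by (intro same) (use minus mb in auto)
    qed
  qed
  then show ?thesis unfolding id' by linarith
qed

lemma abs_mult_half_diff_le:
  fixes c p q :: real
  assumes "\<bar>p\<bar> \<le> 1" "\<bar>q\<bar> \<le> 1" "0 \<le> c"
  shows "\<bar>c * ((p - q) / 2)\<bar> \<le> c"
proof -
  have "(p - q) / 2 \<le> 1" "- ((p - q) / 2) \<le> 1" using assms(1,2) by (auto simp: abs_le_iff)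
  then have "\<bar>c\<bar> * \<bar>(p - q) / 2\<bar> \<le> \<bar>c\<bar> * 1" by (intro mult_left_mono abs_leI) auto
  then show ?thesis using assms(3) unfolding abs_mult by simp
qed

text \<open>For \<open>b = 2\<close> the second level has period \<open>4\<close>, so a unit shift
  is a quarter turn: the lowest binary digit of \<open>u\<close> decides whether sine and cosine are
  exchanged, the next one determines the sign \<sigma>.\<close>

lemma sin_cos_quarter_period:
  fixes u :: nat and x :: real
  shows "\<exists>\<sigma>. (\<sigma> = 1 \<or> \<sigma> = (-1::real)) \<and>
    (even u \<longrightarrow> sin (2*pi*(x + real u) / 4) = \<sigma> * sin (pi*x/2) \<and> cos (2*pi*(x + real u) / 4) = \<sigma> * cos (pi*x/2)) \<and>
    (odd u \<longrightarrow> sin (2*pi*(x + real u) / 4) = \<sigma> * cos (pi*x/2) \<and> cos (2*pi*(x + real u) / 4) = - \<sigma> * sin (pi*x/2))"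
proof (induction u)
  case 0
  have "2 * pi * x / 4 = pi * x / 2" by simp
  then show ?case by (intro exI[of _ 1]) simp
next
  case (Suc u)
  have *: "2*pi*(x + real (Suc u)) / 4 = 2*pi*(x + real u) / 4 + pi / 2" by (simp add: field_simps)
  have s: "sin (2*pi*(x + real (Suc u)) / 4) = cos (2*pi*(x + real u) / 4)"
    and c: "cos (2*pi*(x + real (Suc u)) / 4) = - sin (2*pi*(x + real u) / 4)"
    unfolding * by (simp_all add: sin_add cos_add)
  obtain \<sigma> where "\<sigma> = 1 \<or> \<sigma> = (-1::real)" 
    "(even u \<longrightarrow> sin (2*pi*(x + real u) / 4) = \<sigma> * sin (pi*x/2) \<and> cos (2*pi*(x + real u) / 4) = \<sigma> * cos (pi*x/2))"
    "(odd u \<longrightarrow> sin (2*pi*(x + real u) / 4) = \<sigma> * cos (pi*x/2) \<and> cos (2*pi*(x + real u) / 4) = - \<sigma> * sin (pi*x/2))"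
    using Suc.IH by blast
  then show ?case unfolding s c
    by (intro exI[of _ "if even u then \<sigma> else - \<sigma>"]) auto
qed

section \<open>Transversality of the difference of two words\<close>

locale weierstrass =
  fixes b :: nat and lam \<gamma> :: real
  assumes b: "b \<ge> 2"
    and lam: "lambda_b b < lam" "lam < 1"
    and gamma: "\<gamma> = 1 / (real b * lam)"
begin

lemma b_pos: "0 < real b" "1 < real b" "2 \<le> real b"
  using b by auto

lemma lam_pos: "0 < lam"
  by (rule less_trans[OF _ h_fun_neg_above_lambda_b(1)[OF b lam]]) (use b in simp)

lemma b_gamma: "real b * \<gamma> * lam = 1"
  using lam_pos b by (simp add: gamma)

lemma gamma_pos: "0 < \<gamma>"
  using lam_pos b by (simp add: gamma)

lemma gamma_less_1: "\<gamma> < 1"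
  using h_fun_neg_above_lambda_b(1)[OF b lam] lam_pos b by (simp add: gamma field_simps)

lemma gamma_div_b: "0 < \<gamma> / real b" "\<gamma> / real b < 1"
  using gamma_pos gamma_less_1 b_pos by (auto simp: field_simps)

lemma inverse_b_less_gamma: "1 / real b < \<gamma>"
  using lam lam_pos b_pos by (simp add: gamma field_simps)

text \<open>
  Up to the factors \<open>4 pi \<gamma>\<close> and \<open>2 pi / b\<close>, \<open>osc\<close> is a difference of two values of the truncated
  \<open>Theta b \<gamma> 0\<close>, and \<open>osc'\<close> is the derivative of \<open>osc\<close> along a common shift of the arguments.
\<close>

definition osc :: "nat \<Rightarrow> real \<Rightarrow> real \<Rightarrow> real" where
  "osc m y y' = (\<Sum>n<m. \<gamma> ^ n * ((sin (2*pi*y / real b ^ Suc n) - sin (2*pi*y' / real b ^ Suc n)) / 2))"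

definition osc' :: "nat \<Rightarrow> real \<Rightarrow> real \<Rightarrow> real" where
  "osc' m y y' = (\<Sum>n<m. (\<gamma> / real b) ^ n * ((cos (2*pi*y / real b ^ Suc n) - cos (2*pi*y' / real b ^ Suc n)) / 2))"

lemma osc_tail:
  assumes "k \<le> m"
  shows "\<bar>osc m y y' - osc k y y'\<bar> \<le> \<gamma> ^ k / (1 - \<gamma>)"
proof -
  have "\<bar>\<gamma> ^ n * ((sin (2*pi*y / real b ^ Suc n) - sin (2*pi*y' / real b ^ Suc n)) / 2)\<bar> \<le> \<gamma> ^ n" for n
    by (rule abs_mult_half_diff_le) (use gamma_pos in auto)
  then show ?thesis
    unfolding osc_def using gamma_pos gamma_less_1 assms by (intro sum_lessThan_diff_le) auto
qed

lemma osc'_tail: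
  assumes "k \<le> m"
  shows "\<bar>osc' m y y' - osc' k y y'\<bar> \<le> (\<gamma> / real b) ^ k / (1 - \<gamma> / real b)"
proof -
  have "\<bar>(\<gamma> / real b) ^ n * ((cos (2*pi*y / real b ^ Suc n) - cos (2*pi*y' / real b ^ Suc n)) / 2)\<bar> \<le> (\<gamma> / real b) ^ n" for n
    by (rule abs_mult_half_diff_le) (use gamma_div_b in auto)
  then show ?thesis
    unfolding osc'_def using gamma_div_b assms by (intro sum_lessThan_diff_le) auto
qed

text \<open>With coordinates exchanged, \<open>(osc 1, osc' 1)\<close> is half the chord between two
  points of the unit circle at angle \<open>2 pi d / b\<close>, so its length does not depend on
  \<open>x\<close>. The tails beyond one level are \<open>1 / (b * lam - 1)\<close> and
  \<open>1 / (b^2 * lam - 1)\<close>, and the requirement of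
  \<open>perturbed_pair_bounded_away\<close> becomes literally
  \<open>h_fun b lam < 0\<close>.\<close>

lemma osc_transversal_ge3:
  assumes b3: "b \<noteq> 2"
  shows "\<exists>e>0. \<forall>m\<ge>2. \<forall>u u' x. u mod b \<noteq> u' mod b \<longrightarrow>
    e < \<bar>osc m (x + real u) (x + real u')\<bar> \<or> e < \<bar>osc' m (x + real u) (x + real u')\<bar>"
proof -
  have bb: "1 < real b * lam" "1 < (real b)^2 * lam"
  proof -
    show *: "1 < real b * lam"
      using h_fun_neg_above_lambda_b(1)[OF b lam] b_pos by (simp add: field_simps)
    have "1 * (real b * lam) \<le> real b * (real b * lam)"
      using b_pos lam_pos by (intro mult_right_mono) auto
    with * show "1 < (real b)^2 * lam" by (simp add: power2_eq_square)
  qed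
  have 1: "\<gamma> / (1 - \<gamma>) = 1 / (real b * lam - 1)"
    using lam_pos b_pos bb by (simp add: gamma field_simps)
  have 2: "\<gamma> / real b / (1 - \<gamma> / real b) = 1 / ((real b)^2 * lam - 1)"
    using lam_pos b_pos bb by (simp add: gamma field_simps power2_eq_square)
  have A: "(\<gamma> / (1 - \<gamma>))^2 + (\<gamma> / real b / (1 - \<gamma> / real b))^2 < (sin (pi / real b))^2"
    using h_fun_neg_above_lambda_b(2)[OF b lam] b3
    unfolding 1 2 h_fun_def by (simp add: power_divide)
  obtain e where e: "0 < e" "\<And>F F1 P Q. (sin (pi / real b))^2 \<le> F^2 + F1^2 \<Longrightarrow>
      \<bar>P - F\<bar> \<le> \<gamma> / (1 - \<gamma>) \<Longrightarrow> \<bar>Q - F1\<bar> \<le> \<gamma> / real b / (1 - \<gamma> / real b) \<Longrightarrow> e < \<bar>P\<bar> \<or> e < \<bar>Q\<bar>"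
    by (rule perturbed_pair_bounded_away[OF _ _ A])
      (use gamma_pos gamma_less_1 gamma_div_b in auto)
  have "e < \<bar>osc m (x + real u) (x + real u')\<bar> \<or> e < \<bar>osc' m (x + real u) (x + real u')\<bar>"
    if m: "m \<ge> 2" and u: "u mod b \<noteq> u' mod b" for m u u' x
  proof (rule e(2))
    let ?y = "x + real u" and ?y' = "x + real u'"
    define d where "d = int u - int u'"
    have "\<not> int b dvd d"
      unfolding d_def using u
      by (metis mod_eq_dvd_iff of_nat_eq_iff of_nat_mod)
    then have "sin (pi / real b) \<le> \<bar>sin (pi * real_of_int d / real b)\<bar>"
      by (rule sin_pi_div_le_abs_sin[OF b])
    moreover have "0 \<le> sin (pi / real b)" using b_pos by (intro sin_ge_zero) (auto simp: field_simps)
    ultimately have "(sin (pi / real b))^2 \<le> \<bar>sin (pi * real_of_int d / real b)\<bar>^2"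
      by (rule power_mono)
    also have "\<dots> = (osc 1 ?y ?y')^2 + (osc' 1 ?y ?y')^2"
    proof -
      define p where "p = 2 * pi * ?y / real b"
      define q where "q = 2 * pi * ?y' / real b"
      have pq: "(p - q) / 2 = pi * real_of_int d / real b" "(q - p) / 2 = - (pi * real_of_int d / real b)"
        using b_pos by (auto simp: p_def q_def d_def field_simps)
      have "osc 1 ?y ?y' = sin ((p - q) / 2) * cos ((p + q) / 2)"
        by (simp add: osc_def sin_diff_sin flip: p_def q_def)
      moreover have "osc' 1 ?y ?y' = sin ((p + q) / 2) * sin ((q - p) / 2)"
        by (simp add: osc'_def cos_diff_cos flip: p_def q_def)
      moreover have "(s * c)^2 + (s' * - s)^2 = s^2" if "s'^2 + c^2 = 1" for s s' c :: real
      proof -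
        have "(s * c)^2 + (s' * - s)^2 = s^2 * (s'^2 + c^2)" by (simp add: power2_eq_square algebra_simps)
        then show ?thesis using that by simp
      qed
      ultimately show ?thesis unfolding pq by simp
    qed
    finally show "(sin (pi / real b))^2 \<le> (osc 1 ?y ?y')^2 + (osc' 1 ?y ?y')^2" .
    show "\<bar>osc m ?y ?y' - osc 1 ?y ?y'\<bar> \<le> \<gamma> / (1 - \<gamma>)"
      using osc_tail[of 1 m ?y ?y'] m by simp
    show "\<bar>osc' m ?y ?y' - osc' 1 ?y ?y'\<bar> \<le> \<gamma> / real b / (1 - \<gamma> / real b)"
      using osc'_tail[of 1 m ?y ?y'] m by simp
  qed
  then show ?thesis using e(1) by blast
qed

lemma osc_commute: "osc m y y' = - osc m y' y" "osc' m y y' = - osc' m y' y"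
proof -
  have "c * ((p - q) / 2) = - (c * ((q - p) / 2))" for c p q :: real by (simp add: field_simps)
  then show "osc m y y' = - osc m y' y" "osc' m y y' = - osc' m y' y"
    unfolding osc_def osc'_def sum_negf[symmetric] by (intro sum.cong refl; blast)+
qed

text \<open>Words of different parity make the first level, up to sign, the unit vector
  \<open>(sin (pi * x), cos (pi * x))\<close>. Keeping the second level as well shortens the tails
  by a factor; written in terms of \<gamma>, \<open>h_fun 2 lam < 0\<close> compares these tails
  with \<open>two_level_bound\<close>. The range of \<open>x\<close> makes the sine and cosine of
  \<open>pi * x / 2\<close> nonnegative, as that bound requires.\<close>

lemma osc_transversal_2:
  assumes b2: "b = 2"
  shows "\<exists>e>0. \<forall>m\<ge>2. \<forall>u u' x. 0 \<le> x \<and> x \<le> 1 \<and> u mod b \<noteq> u' mod b \<longrightarrow>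
    e < \<bar>osc m (x + real u) (x + real u')\<bar> \<or> e < \<bar>osc' m (x + real u) (x + real u')\<bar>"
proof -
  have lg: "lam = 1 / (2 * \<gamma>)" using b_gamma gamma_pos b2 by (simp add: field_simps)
  have A: "(\<gamma>^2 / (1 - \<gamma>))^2 + ((\<gamma> / real b)^2 / (1 - \<gamma> / real b))^2 < 1 - sqrt 2 * \<gamma> + 5 * \<gamma>^2 / 16"
  proof -
    have e1: "2 * lam - 1 = (1 - \<gamma>) / \<gamma>" "4 * lam - 1 = (2 - \<gamma>) / \<gamma>" "lam^2 = 1 / (4 * \<gamma>^2)"
      using gamma_pos by (auto simp: lg field_simps power2_eq_square)
    have "1 / (4 * lam^2 * (2 * lam - 1)^2) = (\<gamma>^2 / (1 - \<gamma>))^2"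
      unfolding e1 using gamma_pos gamma_less_1 by (simp add: field_simps power2_eq_square)
    moreover have "1 / (16 * lam^2 * (4 * lam - 1)^2) = ((\<gamma> / real b)^2 / (1 - \<gamma> / real b))^2"
      unfolding e1 b2 using gamma_pos gamma_less_1 by (simp add: field_simps power2_eq_square)
    moreover have "5 / (64 * lam^2) = 5 * \<gamma>^2 / 16"
      unfolding e1 using gamma_pos gamma_less_1 by (simp add: field_simps power2_eq_square)
    moreover have "sqrt 2 / (2 * lam) = sqrt 2 * \<gamma>"
      unfolding lg using gamma_pos gamma_less_1 by (simp add: field_simps)
    ultimately show ?thesis
      using h_fun_neg_above_lambda_b(2)[OF b lam] by (simp add: h_fun_def b2)
  qed
  obtain e where e: "0 < e" "\<And>F F1 P Q. 1 - sqrt 2 * \<gamma> + 5 * \<gamma>^2 / 16 \<le> F^2 + F1^2 \<Longrightarrow>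
      \<bar>P - F\<bar> \<le> \<gamma>^2 / (1 - \<gamma>) \<Longrightarrow> \<bar>Q - F1\<bar> \<le> (\<gamma> / real b)^2 / (1 - \<gamma> / real b) \<Longrightarrow> e < \<bar>P\<bar> \<or> e < \<bar>Q\<bar>"
    by (rule perturbed_pair_bounded_away[OF _ _ A])
      (use gamma_pos gamma_less_1 gamma_div_b in auto)
  have two: "1 - sqrt 2 * \<gamma> + 5 * \<gamma>^2 / 16 \<le> (osc 2 (x + real u) (x + real u'))^2 + (osc' 2 (x + real u) (x + real u'))^2"
    if x: "0 \<le> x" "x \<le> 1" and u: "even u" "odd u'" for x u u'
  proof -
    define s where "s = sin (pi * x / 2)"
    define c where "c = cos (pi * x / 2)"
    have "0 \<le> s" "0 \<le> c"
      unfolding s_def c_def using x by (auto intro!: sin_ge_zero cos_ge_zero simp: mult_left_le)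
        (smt (verit) mult_nonneg_nonneg pi_ge_zero divide_nonneg_nonneg)+
    have sc: "s^2 + c^2 = 1" by (simp add: s_def c_def)
    obtain \<sigma> where sig: "\<sigma> = 1 \<or> \<sigma> = -1"
      "sin (2*pi*(x + real u) / 4) = \<sigma> * s" "cos (2*pi*(x + real u) / 4) = \<sigma> * c"
      using sin_cos_quarter_period[of u x] u by (auto simp: s_def c_def)
    obtain \<tau> where tau: "\<tau> = 1 \<or> \<tau> = -1"
      "sin (2*pi*(x + real u') / 4) = \<tau> * c" "cos (2*pi*(x + real u') / 4) = - \<tau> * s"
      using sin_cos_quarter_period[of u' x] u by (auto simp: s_def c_def)
    have dbl: "sin (2*pi*y / 2) = 2 * sin (2*pi*y / 4) * cos (2*pi*y / 4)"
      "cos (2*pi*y / 2) = cos (2*pi*y / 4)^2 - sin (2*pi*y / 4)^2" for y :: real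
    proof -
      have "2*pi*y / 2 = 2 * (2*pi*y / 4)" by simp
      then show "sin (2*pi*y / 2) = 2 * sin (2*pi*y / 4) * cos (2*pi*y / 4)"
        "cos (2*pi*y / 2) = cos (2*pi*y / 4)^2 - sin (2*pi*y / 4)^2"
        by (simp_all only: sin_double cos_double)
    qed
    have two: "{..<2} = {0, 1::nat}" by auto
    have ss: "\<sigma> * \<sigma> = 1" "\<tau> * \<tau> = 1" using sig tau by auto
    have "sin (2*pi*(x + real u) / 2) = (\<sigma> * \<sigma>) * (2 * s * c)"
      "sin (2*pi*(x + real u') / 2) = (\<tau> * \<tau>) * (- 2 * s * c)"
      "cos (2*pi*(x + real u) / 2) = (\<sigma> * \<sigma>) * (c^2 - s^2)"
      "cos (2*pi*(x + real u') / 2) = (\<tau> * \<tau>) * (s^2 - c^2)"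
      unfolding dbl sig(2,3) tau(2,3) by (simp_all add: power2_eq_square algebra_simps)
    note lev1 = this[unfolded ss mult_1]
    have exp: "osc 2 y y' = (sin (2*pi*y / 2) - sin (2*pi*y' / 2)) / 2
        + \<gamma> * ((sin (2*pi*y / 4) - sin (2*pi*y' / 4)) / 2)"
      "osc' 2 y y' = (cos (2*pi*y / 2) - cos (2*pi*y' / 2)) / 2
        + \<gamma> / 2 * ((cos (2*pi*y / 4) - cos (2*pi*y' / 4)) / 2)" for y y'
      unfolding osc_def osc'_def two unfolding b2 by simp_all
    have "osc 2 (x + real u) (x + real u') = 2 * s * c + \<gamma> / 2 * (\<sigma> * s - \<tau> * c)"
      unfolding exp lev1 sig(2) tau(2) by (simp add: field_simps)
    moreover have "osc' 2 (x + real u) (x + real u') = c^2 - s^2 + \<gamma> / 4 * (\<sigma> * c + \<tau> * s)"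
      unfolding exp lev1 sig(3) tau(3) by (simp add: field_simps)
    ultimately show ?thesis
      using two_level_bound[OF sc \<open>0 \<le> s\<close> \<open>0 \<le> c\<close> gamma_pos gamma_less_1 sig(1) tau(1)] by simp
  qed
  have "e < \<bar>osc m (x + real u) (x + real u')\<bar> \<or> e < \<bar>osc' m (x + real u) (x + real u')\<bar>"
    if m: "m \<ge> 2" and u: "u mod b \<noteq> u' mod b" and x: "0 \<le> x" "x \<le> 1" for m u u' x
  proof (rule e(2))
    let ?y = "x + real u" and ?y' = "x + real u'"
    show "\<bar>osc m ?y ?y' - osc 2 ?y ?y'\<bar> \<le> \<gamma>^2 / (1 - \<gamma>)"
      using osc_tail[of 2 m ?y ?y'] m by simp
    show "\<bar>osc' m ?y ?y' - osc' 2 ?y ?y'\<bar> \<le> (\<gamma> / real b)^2 / (1 - \<gamma> / real b)"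
      using osc'_tail[of 2 m ?y ?y'] m by simp
    consider "even u" "odd u'" | "odd u" "even u'" using u unfolding b2 mod2_eq_if
      by (auto split: if_splits)
    then show "1 - sqrt 2 * \<gamma> + 5 * \<gamma>^2 / 16 \<le> (osc 2 ?y ?y')^2 + (osc' 2 ?y ?y')^2"
    proof cases
      case 1 then show ?thesis using two x by blast
    next
      case 2 then show ?thesis using two[OF x, of u' u] by (simp add: osc_commute[of 2 ?y ?y'])
    qed
  qed
  then show ?thesis using e(1) by blast
qed

lemma osc_transversal:
  obtains e where "0 < e" "\<And>m u u' x. 2 \<le> m \<Longrightarrow> 0 \<le> x \<Longrightarrow> x \<le> 1 \<Longrightarrow> u mod b \<noteq> u' mod b \<Longrightarrow>
    e < \<bar>osc m (x + real u) (x + real u')\<bar> \<or> e < \<bar>osc' m (x + real u) (x + real u')\<bar>"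
  using osc_transversal_2 osc_transversal_ge3 by (cases "b = 2") blast+

end

section \<open>Measure of close pairs of words\<close>

lemma abs_cos_diff_le: "\<bar>cos p - cos q\<bar> \<le> \<bar>p - q\<bar>" for p q :: real
proof -
  have "\<bar>cos p - cos q\<bar> = 2 * (\<bar>sin ((p + q) / 2)\<bar> * \<bar>sin ((q - p) / 2)\<bar>)"
    by (simp add: cos_diff_cos abs_mult)
  also have "\<dots> \<le> 2 * (1 * \<bar>(q - p) / 2\<bar>)"
    by (intro mult_left_mono mult_mono abs_sin_x_le_abs_x) auto
  finally show ?thesis by (simp add: abs_minus_commute)
qed

lemma abs_sin_diff_le: "\<bar>sin p - sin q\<bar> \<le> \<bar>p - q\<bar>" for p q :: real
proof -
  have "\<bar>sin p - sin q\<bar> = 2 * (\<bar>sin ((p - q) / 2)\<bar> * \<bar>cos ((p + q) / 2)\<bar>)"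
    by (simp add: sin_diff_sin abs_mult)
  also have "\<dots> \<le> 2 * (\<bar>(p - q) / 2\<bar> * 1)"
    by (intro mult_left_mono mult_mono abs_sin_x_le_abs_x) auto
  finally show ?thesis by simp
qed

text \<open>Cut the interval into \<open>K\<close> pieces so short that \<open>f'\<close> varies by
  at most \<open>\<kappa> / 2\<close> on each. If \<open>\<rho> < \<kappa>\<close>, a point of the
  sublevel set has derivative above \<kappa>, hence at least \<open>\<kappa> / 2\<close> nearby, and
  the mean value theorem keeps the rest of its piece's share within
  \<open>4 * \<rho> / \<kappa>\<close>. If \<open>\<kappa> \<le> \<rho>\<close>, the bound exceeds
  the total length.\<close>

lemma emeasure_transversal_sublevel:
  fixes f f' :: "real \<Rightarrow> real"
  assumes f: "\<And>x. (f has_real_derivative f' x) (at x)"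
    and lip: "\<And>x y. \<bar>f' x - f' y\<bar> \<le> L * \<bar>x - y\<bar>"
    and trans: "\<And>x. 0 \<le> x \<Longrightarrow> x \<le> 1 \<Longrightarrow> \<kappa> < \<bar>f x\<bar> \<or> \<kappa> < \<bar>f' x\<bar>"
    and \<kappa>: "0 < \<kappa>" and K: "0 < K" "2 * L \<le> \<kappa> * real K" and \<rho>: "0 \<le> \<rho>"
  shows "emeasure lborel {x\<in>{0..<1}. \<bar>f x\<bar> \<le> \<rho>} \<le> ennreal (8 * real K / \<kappa> * \<rho>)"
proof (cases "\<kappa> \<le> \<rho>")
  case True
  have "emeasure lborel {x\<in>{0..<1}. \<bar>f x\<bar> \<le> \<rho>} \<le> emeasure lborel {0..<1::real}"
    by (intro emeasure_mono) auto
  also have "\<dots> = ennreal 1" by simp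
  also have "\<dots> \<le> ennreal (8 * real K / \<kappa> * \<rho>)"
  proof (rule ennreal_leI)
    have "1 * 1 \<le> 8 * real K * (\<rho> / \<kappa>)" 
      using K(1) True \<kappa> \<rho> by (intro mult_mono) auto
    then show "1 \<le> 8 * real K / \<kappa> * \<rho>" by simp
  qed
  finally show ?thesis .
next
  case False
  let ?S = "{x\<in>{0..<1}. \<bar>f x\<bar> \<le> \<rho>}"
  have L0: "0 \<le> L" using lip[of 1 0] by (simp add: order.trans[OF abs_ge_zero])
  have close: "\<bar>y - x\<bar> \<le> 4 * \<rho> / \<kappa>" 
    if xy: "x \<in> ?S" "y \<in> ?S" "x < y" "y - x \<le> 1 / real K" for x y
  proof -
    obtain z where z: "x < z" "z < y" "f y - f x = (y - x) * f' z"
      using MVT2[of x y f f'] xy f by blast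
    have "\<kappa> < \<bar>f' x\<bar>" using trans[of x] xy False by auto
    have "L * \<bar>z - x\<bar> \<le> L * (1 / real K)"
      using z xy L0 by (intro mult_left_mono) auto
    also have "\<dots> \<le> \<kappa> / 2" using K by (simp add: field_simps)
    finally have "\<bar>f' z - f' x\<bar> \<le> \<kappa> / 2" using lip[of z x] by linarith
    then have "\<kappa> / 2 \<le> \<bar>f' z\<bar>" using \<open>\<kappa> < \<bar>f' x\<bar>\<close> by linarith
    then have "(y - x) * (\<kappa> / 2) \<le> (y - x) * \<bar>f' z\<bar>" using xy by (intro mult_left_mono) auto
    also have "\<dots> = \<bar>f y - f x\<bar>" using xy unfolding z(3) by (simp add: abs_mult)
    also have "\<dots> \<le> 2 * \<rho>" using xy by auto
    finally show ?thesis using xy \<kappa> by (simp add: field_simps)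
  qed
  have "\<exists>c. ?S \<inter> {real j / real K..<real (Suc j) / real K} \<subseteq> {c - 4 * \<rho> / \<kappa>..c + 4 * \<rho> / \<kappa>}" for j
  proof (cases "?S \<inter> {real j / real K..<real (Suc j) / real K} = {}")
    case False
    then obtain c where c: "c \<in> ?S" "c \<in> {real j / real K..<real (Suc j) / real K}" by blast
    have "y \<in> {c - 4 * \<rho> / \<kappa>..c + 4 * \<rho> / \<kappa>}"
      if y: "y \<in> ?S" "y \<in> {real j / real K..<real (Suc j) / real K}" for y
    proof -
      have "real (Suc j) / real K = real j / real K + 1 / real K" by (simp add: add_divide_distrib)
      then have "\<bar>y - c\<bar> \<le> 1 / real K" using y(2) c(2) by auto
      then have "\<bar>y - c\<bar> \<le> 4 * \<rho> / \<kappa>"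
        using close[OF y(1) c(1)] close[OF c(1) y(1)] \<rho> \<kappa> by (cases y c rule: linorder_cases) auto
      then show ?thesis by auto
    qed
    then show ?thesis by blast
  qed auto
  then have "\<forall>j. \<exists>c. ?S \<inter> {real j / real K..<real (Suc j) / real K} \<subseteq> {c - 4 * \<rho> / \<kappa>..c + 4 * \<rho> / \<kappa>}" by blast
  from choice[OF this] obtain c where c: "\<And>j. ?S \<inter> {real j / real K..<real (Suc j) / real K} \<subseteq> {c j - 4 * \<rho> / \<kappa>..c j + 4 * \<rho> / \<kappa>}"
    by blast
  have "?S \<subseteq> (\<Union>j<K. {c j - 4 * \<rho> / \<kappa>..c j + 4 * \<rho> / \<kappa>})"
  proof
    fix x assume x: "x \<in> ?S"
    define j where "j = nat \<lfloor>x * real K\<rfloor>"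
    have "real j = of_int \<lfloor>x * real K\<rfloor>" using x by (simp add: j_def)
    then have j: "real j \<le> x * real K" "x * real K < real j + 1" by linarith+
    have "x * real K < 1 * real K" using x K by (intro mult_strict_right_mono) auto
    then have "real j < real K" using j by linarith
    moreover have "x \<in> {real j / real K..<real (Suc j) / real K}" using j K by (simp add: field_simps)
    then have "x \<in> {c j - 4 * \<rho> / \<kappa>..c j + 4 * \<rho> / \<kappa>}" using c[of j] x by blast
    ultimately show "x \<in> (\<Union>j<K. {c j - 4 * \<rho> / \<kappa>..c j + 4 * \<rho> / \<kappa>})" by auto
  qed
  then have "emeasure lborel ?S \<le> emeasure lborel (\<Union>j<K. {c j - 4 * \<rho> / \<kappa>..c j + 4 * \<rho> / \<kappa>})"
    by (intro emeasure_mono) auto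
  also have "\<dots> \<le> (\<Sum>j<K. emeasure lborel {c j - 4 * \<rho> / \<kappa>..c j + 4 * \<rho> / \<kappa>})"
    by (intro emeasure_subadditive_finite) auto
  also have "\<dots> = (\<Sum>j<K. ennreal (8 * \<rho> / \<kappa>))"
    using \<rho> \<kappa> by (intro sum.cong refl, subst emeasure_lborel_Icc) (auto intro!: arg_cong[where f=ennreal])
  also have "\<dots> = ennreal (8 * real K / \<kappa> * \<rho>)"
    using \<rho> \<kappa> by (simp add: ennreal_of_nat_eq_real_of_nat flip: ennreal_mult)
  finally show ?thesis .
qed

text \<open>The branches sending \<open>x\<close> to \<open>(x + k) / K\<close> tile the unit
  interval, each contracting lengths by \<open>K\<close>. The identity averages over a shared first
  digit in the recursion for pairs, and over the digits already read when exceptional points are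
  measured.\<close>

lemma emeasure_sum_translates:
  fixes A :: "real set"
  assumes K: "0 < K" and [measurable]: "A \<in> sets borel"
  shows "(\<Sum>k<K. emeasure lborel {x\<in>{0..<1}. (x + real k) / real K \<in> A}) = of_nat K * emeasure lborel (A \<inter> {0..<1})"
proof -
  have piece: "emeasure lborel {x\<in>{0..<1}. (x + real k) / real K \<in> A}
      = of_nat K * emeasure lborel (A \<inter> {real k / real K..<real (Suc k) / real K})" for k
  proof -
    have "of_nat K * emeasure lborel (A \<inter> {real k / real K..<real (Suc k) / real K})
        = of_nat K * (\<integral>\<^sup>+ x. indicator (A \<inter> {real k / real K..<real (Suc k) / real K}) x \<partial>lborel)"
      by simp
    also have "\<dots> = of_nat K * (ennreal \<bar>1 / real K\<bar> * (\<integral>\<^sup>+ x. indicator (A \<inter> {real k / real K..<real (Suc k) / real K}) (real k / real K + 1 / real K * x) \<partial>lborel))"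
      using K by (subst nn_integral_real_affine[where t = "real k / real K" and c = "1 / real K"]) auto
    also have "(\<lambda>x. indicator (A \<inter> {real k / real K..<real (Suc k) / real K}) (real k / real K + 1 / real K * x))
        = (indicator {x\<in>{0..<1}. (x + real k) / real K \<in> A} :: real \<Rightarrow> ennreal)"
      using K by (intro ext) (auto simp: indicator_def field_simps)
    also have "of_nat K * (ennreal \<bar>1 / real K\<bar> * (\<integral>\<^sup>+ x. indicator {x\<in>{0..<1}. (x + real k) / real K \<in> A} x \<partial>lborel))
       = emeasure lborel {x\<in>{0..<1}. (x + real k) / real K \<in> A}"
      using K by (simp add: ennreal_of_nat_eq_real_of_nat flip: mult.assoc ennreal_mult)
    finally show ?thesis ..
  qed
  have "(\<Sum>k<K. emeasure lborel {x\<in>{0..<1}. (x + real k) / real K \<in> A})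
      = of_nat K * (\<Sum>k<K. emeasure lborel (A \<inter> {real k / real K..<real (Suc k) / real K}))"
    unfolding piece sum_distrib_left ..
  also have "(\<Sum>k<K. emeasure lborel (A \<inter> {real k / real K..<real (Suc k) / real K}))
      = emeasure lborel (\<Union>k<K. A \<inter> {real k / real K..<real (Suc k) / real K})"
  proof (rule sum_emeasure)
    have "\<lfloor>x * real K\<rfloor> = int k" if "x \<in> {real k / real K..<real (Suc k) / real K}" for x k
      using that K by (intro floor_unique) (auto simp: field_simps)
    then show "disjoint_family_on (\<lambda>k. A \<inter> {real k / real K..<real (Suc k) / real K}) {..<K}"
      unfolding disjoint_family_on_def by (metis (no_types, lifting) IntD2 disjoint_iff of_nat_eq_iff)
  qed auto
  also have "(\<Union>k<K. A \<inter> {real k / real K..<real (Suc k) / real K}) = A \<inter> {0..<1}"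
  proof -
    have "(\<Union>k<K. {real k / real K..<real (Suc k) / real K}) = {0..<1}"
    proof (intro set_eqI iffI)
      fix x :: real assume "x \<in> (\<Union>k<K. {real k / real K..<real (Suc k) / real K})"
      then obtain k where k: "k < K" "real k / real K \<le> x" "x < real (Suc k) / real K" by auto
      have "real (Suc k) / real K \<le> 1" using k(1) by (simp add: field_simps)
      moreover have "0 \<le> real k / real K" by simp
      ultimately show "x \<in> {0..<1}" using order.trans[OF _ k(2)] less_le_trans[OF k(3)] by simp
    next
      fix x :: real assume x: "x \<in> {0..<1}"
      define j where "j = nat \<lfloor>x * real K\<rfloor>"
      have "real j = of_int \<lfloor>x * real K\<rfloor>" using x by (simp add: j_def)
      then have j: "real j \<le> x * real K" "x * real K < real j + 1" by linarith+
      have "x * real K < 1 * real K" using x K by (intro mult_strict_right_mono) auto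
      then have "real j < real K" using j by linarith
      moreover have "x \<in> {real j / real K..<real (Suc j) / real K}" using j K by (simp add: field_simps)
      ultimately show "x \<in> (\<Union>k<K. {real k / real K..<real (Suc k) / real K})" by auto
    qed
    then show ?thesis by (simp flip: Int_UN_distrib)
  qed
  finally show ?thesis .
qed

context weierstrass
begin

lemma osc_derivative:
  "((\<lambda>x. osc m (x + u) (x + u')) has_real_derivative (2 * pi / real b * osc' m (x + u) (x + u'))) (at x)"
proof -
  have "((\<lambda>x. osc m (x + u) (x + u')) has_real_derivative
    (\<Sum>n<m. \<gamma> ^ n * ((cos (2*pi*(x + u) / real b ^ Suc n) * (2 * pi / real b ^ Suc n)
       - cos (2*pi*(x + u') / real b ^ Suc n) * (2 * pi / real b ^ Suc n)) / 2))) (at x)"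
    unfolding osc_def using b_pos by (auto intro!: derivative_eq_intros)
  also have "(\<Sum>n<m. \<gamma> ^ n * ((cos (2*pi*(x + u) / real b ^ Suc n) * (2 * pi / real b ^ Suc n)
       - cos (2*pi*(x + u') / real b ^ Suc n) * (2 * pi / real b ^ Suc n)) / 2))
     = 2 * pi / real b * osc' m (x + u) (x + u')"
    unfolding osc'_def sum_distrib_left
  proof (intro sum.cong refl)
    fix n
    have "\<gamma> ^ n * ((p * (2 * pi / real b ^ Suc n) - q * (2 * pi / real b ^ Suc n)) / 2)
        = 2 * pi / real b * ((\<gamma> / real b) ^ n * ((p - q) / 2))" for p q
      using b_pos by (simp add: field_simps power_divide)
    then show "\<gamma> ^ n * ((cos (2*pi*(x + u) / real b ^ Suc n) * (2 * pi / real b ^ Suc n)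
       - cos (2*pi*(x + u') / real b ^ Suc n) * (2 * pi / real b ^ Suc n)) / 2)
      = 2 * pi / real b * ((\<gamma> / real b) ^ n
       * ((cos (2*pi*(x + u) / real b ^ Suc n) - cos (2*pi*(x + u') / real b ^ Suc n)) / 2))" .
  qed
  finally show ?thesis .
qed

lemma osc'_lipschitz:
  "\<bar>osc' m (x + u) (x + u') - osc' m (y + u) (y + u')\<bar> \<le> 2 * pi / (1 - \<gamma> / real b) * \<bar>x - y\<bar>"
proof -
  have lip: "\<bar>cos (2*pi*(x + v) / real b ^ Suc n) - cos (2*pi*(y + v) / real b ^ Suc n)\<bar> \<le> 2 * pi * \<bar>x - y\<bar>" for v n
  proof -
    have "\<bar>cos (2*pi*(x + v) / real b ^ Suc n) - cos (2*pi*(y + v) / real b ^ Suc n)\<bar>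
       \<le> \<bar>2*pi*(x + v) / real b ^ Suc n - 2*pi*(y + v) / real b ^ Suc n\<bar>" by (rule abs_cos_diff_le)
    also have "2*pi*(x + v) / real b ^ Suc n - 2*pi*(y + v) / real b ^ Suc n = (2 * pi / real b ^ Suc n) * (x - y)"
      by (simp add: diff_divide_distrib ring_distribs add_divide_distrib)
    also have "\<bar>\<dots>\<bar> = 2 * pi * \<bar>x - y\<bar> / real b ^ Suc n"
      using b_pos by (simp add: abs_mult)
    also have "\<dots> \<le> 2 * pi * \<bar>x - y\<bar> / 1"
      using b_pos by (intro divide_left_mono one_le_power) auto
    finally show ?thesis by simp
  qed
  have "\<bar>osc' m (x + u) (x + u') - osc' m (y + u) (y + u')\<bar> \<le> (\<Sum>n<m. (\<gamma> / real b) ^ n * (2 * pi * \<bar>x - y\<bar>))"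
    unfolding osc'_def sum_subtractf[symmetric] right_diff_distrib[symmetric] diff_divide_distrib[symmetric]
  proof (rule order.trans[OF sum_abs sum_mono])
    fix n
    let ?c = "\<lambda>z. cos (2*pi*z / real b ^ Suc n)"
    have "\<bar>(?c (x + u) - ?c (x + u') - (?c (y + u) - ?c (y + u'))) / 2\<bar> \<le> 2 * pi * \<bar>x - y\<bar>"
      using lip[of u n] lip[of u' n] by (auto simp: abs_le_iff)
    then have "\<bar>(\<gamma> / real b) ^ n\<bar> * \<bar>(?c (x + u) - ?c (x + u') - (?c (y + u) - ?c (y + u'))) / 2\<bar> \<le> \<bar>(\<gamma> / real b) ^ n\<bar> * (2 * pi * \<bar>x - y\<bar>)"
      by (intro mult_left_mono) auto
    then show "\<bar>(\<gamma> / real b) ^ n * ((?c (x + u) - ?c (x + u') - (?c (y + u) - ?c (y + u'))) / 2)\<bar> \<le> (\<gamma> / real b) ^ n * (2 * pi * \<bar>x - y\<bar>)"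
      using gamma_div_b(1) unfolding abs_mult by simp
  qed
  also have "\<dots> = (\<Sum>n<m. (\<gamma> / real b) ^ n) * (2 * pi * \<bar>x - y\<bar>)" by (simp add: sum_distrib_right)
  also have "\<dots> \<le> (1 / (1 - \<gamma> / real b)) * (2 * pi * \<bar>x - y\<bar>)"
    using sum_power_interval_le[of "\<gamma> / real b" 0 m] gamma_div_b
    by (intro mult_right_mono) (auto simp: lessThan_atLeast0)
  finally show ?thesis by (simp add: field_simps)
qed

lemma emeasure_osc_small:
  obtains C where "0 < C" "\<And>(m::nat) (u::nat) (u'::nat) (\<rho>::real). 2 \<le> m \<Longrightarrow> u mod b \<noteq> u' mod b \<Longrightarrow> 0 \<le> \<rho> \<Longrightarrow>
    emeasure lborel {x\<in>{0..<1}. \<bar>osc m (x + real u) (x + real u')\<bar> \<le> \<rho>} \<le> ennreal (C * \<rho>)"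
proof -
  obtain e where e: "0 < e" "\<And>(m::nat) (u::nat) (u'::nat) (x::real). 2 \<le> m \<Longrightarrow> 0 \<le> x \<Longrightarrow> x \<le> 1 \<Longrightarrow> u mod b \<noteq> u' mod b \<Longrightarrow>
    e < \<bar>osc m (x + real u) (x + real u')\<bar> \<or> e < \<bar>osc' m (x + real u) (x + real u')\<bar>"
    using osc_transversal by blast
  \<comment> \<open>The derivative of \<open>osc\<close> is \<open>2 * pi / b\<close> times
    \<open>osc'\<close>, so its threshold is rescaled. Neither \<open>e\<close> nor \<open>L\<close>
    depends on \<open>m\<close> or on the words, hence neither does the resulting constant.\<close>
  define k where "k = min e (2 * pi / real b * e)"
  define L where "L = 2 * pi / real b * (2 * pi / (1 - \<gamma> / real b))"
  have k: "0 < k" using e b_pos by (simp add: k_def)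
  obtain K where "real K > max 0 (2 * L / k)" using reals_Archimedean2 by blast
  then have K: "0 < K" "2 * L \<le> k * real K" using k by (auto simp: field_simps)
  show ?thesis
  proof (rule that)
    show "0 < 8 * real K / k" using K k by simp
    fix m u u' :: nat and \<rho> :: real assume m: "2 \<le> m" "u mod b \<noteq> u' mod b" "0 \<le> \<rho>"
    show "emeasure lborel {x\<in>{0..<1}. \<bar>osc m (x + real u) (x + real u')\<bar> \<le> \<rho>} \<le> ennreal (8 * real K / k * \<rho>)"
    proof (rule emeasure_transversal_sublevel[OF osc_derivative _ _ k K m(3)])
      fix x y :: real
      let ?d = "\<lambda>x. osc' m (x + real u) (x + real u')"
      have "\<bar>2 * pi / real b * ?d x - 2 * pi / real b * ?d y\<bar> = 2 * pi / real b * \<bar>?d x - ?d y\<bar>"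
        using b_pos by (simp add: abs_mult flip: right_diff_distrib diff_divide_distrib)
      also have "\<dots> \<le> 2 * pi / real b * (2 * pi / (1 - \<gamma> / real b) * \<bar>x - y\<bar>)"
        using b_pos by (intro mult_left_mono osc'_lipschitz) auto
      finally show "\<bar>2 * pi / real b * ?d x - 2 * pi / real b * ?d y\<bar> \<le> L * \<bar>x - y\<bar>"
        by (simp add: L_def mult.assoc)
    next
      fix x :: real assume x: "0 \<le> x" "x \<le> 1"
      have "2 * pi / real b * e < 2 * pi / real b * \<bar>osc' m (x + real u) (x + real u')\<bar>"
        if "e < \<bar>osc' m (x + real u) (x + real u')\<bar>"
        using b_pos that by (intro mult_strict_left_mono) auto
      then show "k < \<bar>osc m (x + real u) (x + real u')\<bar> \<or> k < \<bar>2 * pi / real b * osc' m (x + real u) (x + real u')\<bar>"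
        using e(2)[OF m(1) x m(2)] by (auto simp: k_def abs_mult)
    qed
  qed
qed

end

section \<open>Recursion over the first digit in which two words differ\<close>

lemma sum_lessThan_mult:
  fixes f :: "nat \<Rightarrow> 'a::comm_monoid_add"
  shows "(\<Sum>u<K * n. f u) = (\<Sum>v<n. \<Sum>k<K. f (k + K * v))"
proof -
  have "(\<Sum>k<K. f (k + K * v)) = sum f {v * K..<v * K + K}" for v
    by (subst sum.atLeastLessThan_shift_0) (simp add: lessThan_atLeast0 ac_simps)
  then show ?thesis by (simp add: sum.nat_group mult.commute)
qed

lemma sin_2pi_add_nat: "sin (2 * pi * (y + real k)) = sin (2 * pi * y)"
proof -
  have "2 * pi * (y + real k) = 2 * pi * y + 2 * real k * pi" by (simp add: algebra_simps)
  then show ?thesis by (simp only: sin_add sin_2npi cos_2npi)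
qed

context weierstrass
begin

definition wave :: "nat \<Rightarrow> real \<Rightarrow> real" where
  "wave m y = (\<Sum>n<m. \<gamma> ^ Suc n * (2 * pi) * sin (2 * pi * (y / real b ^ Suc n)))"

definition wave_close :: "nat \<Rightarrow> real \<Rightarrow> nat \<Rightarrow> nat \<Rightarrow> real set" where
  "wave_close m \<rho> u u' = {x. \<bar>wave m (x + real u) - wave m (x + real u')\<bar> \<le> \<rho>}"

lemma wave_measurable [measurable]: "wave m \<in> borel_measurable borel"
  unfolding wave_def[abs_def] by measurable

lemma wave_close_measurable [measurable]: "wave_close m \<rho> u u' \<in> sets borel"
  unfolding wave_close_def by measurable

lemma wave_diff: "wave m y - wave m y' = 4 * pi * \<gamma> * osc m y y'"
  unfolding wave_def osc_def sum_subtractf[symmetric] sum_distrib_left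
  by (intro sum.cong refl) (simp add: field_simps)

lemma wave_Suc: "wave (Suc m) y = \<gamma> * (2 * pi) * sin (2 * pi * (y / real b)) + \<gamma> * wave m (y / real b)"
  unfolding wave_def sum_distrib_left by (subst sum.lessThan_Suc_shift) (simp add: mult.assoc)

text \<open>A shared first digit \<open>k\<close> cancels the first level. The other levels are
  those of the shortened words seen from \<open>(x + k) / b\<close>, scaled by \<gamma>, so the
  threshold grows to \<open>\<rho> / \<gamma>\<close>.\<close>

lemma wave_close_Suc_same_digit:
  "wave_close (Suc m) \<rho> (k + b * v) (k + b * v') = {x. (x + real k) / real b \<in> wave_close m (\<rho> / \<gamma>) v v'}"
proof -
  have arg: "(x + real (k + b * v)) / real b = (x + real k) / real b + real v" for x v
    using b_pos by (simp add: field_simps)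
  have "\<bar>wave (Suc m) (x + real (k + b * v)) - wave (Suc m) (x + real (k + b * v'))\<bar>
      = \<gamma> * \<bar>wave m ((x + real k) / real b + real v) - wave m ((x + real k) / real b + real v')\<bar>" for x
    unfolding wave_Suc arg sin_2pi_add_nat using gamma_pos by (simp add: abs_mult flip: right_diff_distrib)
  then show ?thesis
    unfolding wave_close_def using gamma_pos by (auto simp: field_simps)
qed

text \<open>This is \<open>b ^ (2 * m)\<close> times the probability that two independent uniform
  words of length \<open>m\<close> are close at a uniform point.\<close>

definition pair_measure_sum :: "nat \<Rightarrow> real \<Rightarrow> ennreal" where
  "pair_measure_sum m \<rho> = (\<Sum>u<b ^ m. \<Sum>u'<b ^ m. emeasure lborel (wave_close m \<rho> u u' \<inter> {0..<1}))"

text \<open>The term with \<open>c\<close> charges every pair the price of differing first digits.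
  For a shared digit \<open>k\<close>, summation over \<open>k\<close> reassembles the unit interval
  from its branches and leaves the factor \<open>b\<close>.\<close>

lemma pair_measure_sum_Suc:
  assumes diff: "\<And>u u'. u mod b \<noteq> u' mod b \<Longrightarrow> emeasure lborel (wave_close (Suc m) \<rho> u u' \<inter> {0..<1}) \<le> c"
  shows "pair_measure_sum (Suc m) \<rho>
    \<le> of_nat (b ^ m) * of_nat (b ^ m) * of_nat b * of_nat b * c + of_nat b * pair_measure_sum m (\<rho> / \<gamma>)"
proof -
  let ?E = "\<lambda>u u'. emeasure lborel (wave_close (Suc m) \<rho> u u' \<inter> {0..<1})"
  let ?S = "\<lambda>k v v'. emeasure lborel {x\<in>{0..<1}. (x + real k) / real b \<in> wave_close m (\<rho> / \<gamma>) v v'}"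
  have E: "?E (k + b * v) (k' + b * v') \<le> c + (if k' = k then ?S k v v' else 0)" 
    if "k < b" "k' < b" for k v k' v'
  proof (cases "k = k'")
    case True
    then have "wave_close (Suc m) \<rho> (k + b * v) (k' + b * v') \<inter> {0..<1} 
        = {x\<in>{0..<1}. (x + real k) / real b \<in> wave_close m (\<rho> / \<gamma>) v v'}"
      by (auto simp: wave_close_Suc_same_digit)
    then show ?thesis using True by (simp add: add_increasing)
  next
    case False
    then show ?thesis using that by (auto intro!: diff)
  qed
  have "pair_measure_sum (Suc m) \<rho> = (\<Sum>v<b ^ m. \<Sum>k<b. \<Sum>v'<b ^ m. \<Sum>k'<b. ?E (k + b * v) (k' + b * v'))"
    unfolding pair_measure_sum_def power_Suc sum_lessThan_mult ..
  also have "\<dots> \<le> (\<Sum>v<b ^ m. \<Sum>k<b. \<Sum>v'<b ^ m. \<Sum>k'<b. c + (if k' = k then ?S k v v' else 0))"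
    by (intro sum_mono E) auto
  also have "\<dots> = (\<Sum>v<b ^ m. \<Sum>k<b. \<Sum>v'<b ^ m. of_nat b * c + ?S k v v')"
    by (intro sum.cong refl) (simp add: sum.distrib)
  also have "\<dots> = (\<Sum>v<b ^ m. \<Sum>v'<b ^ m. \<Sum>k<b. of_nat b * c + ?S k v v')"
    by (intro sum.cong refl sum.swap)
  also have "\<dots> = (\<Sum>v<b ^ m. \<Sum>v'<b ^ m. of_nat b * (of_nat b * c) 
      + of_nat b * emeasure lborel (wave_close m (\<rho> / \<gamma>) v v' \<inter> {0..<1}))"
  proof (intro sum.cong refl)
    fix v v'
    have "(\<Sum>k<b. ?S k v v') = of_nat b * emeasure lborel (wave_close m (\<rho> / \<gamma>) v v' \<inter> {0..<1})"
      by (rule emeasure_sum_translates) (use b in auto)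
    then show "(\<Sum>k<b. of_nat b * c + ?S k v v') = of_nat b * (of_nat b * c)
        + of_nat b * emeasure lborel (wave_close m (\<rho> / \<gamma>) v v' \<inter> {0..<1})"
      unfolding sum.distrib by simp
  qed
  also have "\<dots> = of_nat (b ^ m) * of_nat (b ^ m) * of_nat b * of_nat b * c + of_nat b * pair_measure_sum m (\<rho> / \<gamma>)"
    unfolding pair_measure_sum_def by (simp add: sum.distrib sum_distrib_left mult.assoc)
  finally show ?thesis .
qed

text \<open>Divided by \<open>b ^ (2 * m)\<close>, the recursion reads \<open>p (m + 1) \<rho> \<le>
  c * \<rho> + p m (\<rho> / \<gamma>) / b\<close>. A linear bound \<open>C * \<rho>\<close>
  reproduces itself if \<open>C = c + lam * C\<close>, since
  \<open>1 / (b * \<gamma>) = lam\<close>, and \<open>lam < 1\<close> makes this solvable. The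
  summand \<open>b / b ^ m\<close> is the share of the pairs agreeing in all digits except possibly
  the last.\<close>

lemma pair_measure_sum_bound:
  obtains C where "0 < C" "\<And>(m::nat) (\<rho>::real). 1 \<le> m \<Longrightarrow> 0 \<le> \<rho> \<Longrightarrow>
    pair_measure_sum m \<rho> \<le> ennreal (real b ^ m * real b ^ m * (C * \<rho> + real b / real b ^ m))"
proof -
  obtain C0 where C0: "0 < C0" "\<And>(m::nat) (u::nat) (u'::nat) (\<rho>::real). 2 \<le> m \<Longrightarrow> u mod b \<noteq> u' mod b \<Longrightarrow> 0 \<le> \<rho> \<Longrightarrow>
    emeasure lborel {x\<in>{0..<1}. \<bar>osc m (x + real u) (x + real u')\<bar> \<le> \<rho>} \<le> ennreal (C0 * \<rho>)"
    using emeasure_osc_small by blast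
  define c where "c = C0 / (4 * pi * \<gamma>)"
  define C where "C = c / (1 - lam)"
  have c: "0 < c" using C0 gamma_pos by (simp add: c_def)
  then have C: "0 < C" using lam by (simp add: C_def)
  have diff: "emeasure lborel (wave_close m \<rho> u u' \<inter> {0..<1}) \<le> ennreal (c * \<rho>)"
    if "2 \<le> m" "u mod b \<noteq> u' mod b" "0 \<le> \<rho>" for m u u' \<rho>
  proof -
    have "wave_close m \<rho> u u' \<inter> {0..<1} = {x\<in>{0..<1}. \<bar>osc m (x + real u) (x + real u')\<bar> \<le> \<rho> / (4 * pi * \<gamma>)}"
      using gamma_pos by (auto simp: wave_close_def wave_diff abs_mult field_simps)
    then show ?thesis
      using C0(2)[OF that(1,2), of "\<rho> / (4 * pi * \<gamma>)"] that(3) gamma_pos by (simp add: c_def)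
  qed
  have "pair_measure_sum m \<rho> \<le> ennreal (real b ^ m * real b ^ m * (C * \<rho> + real b / real b ^ m))"
    if "1 \<le> m" "0 \<le> \<rho>" for m \<rho>
    using that
  proof (induction m arbitrary: \<rho> rule: nat_induct_at_least)
    \<comment> \<open>Length one gets the trivial bound, as the transversality estimate is stated
      from two levels on.\<close>
    case base
    have "pair_measure_sum 1 \<rho> \<le> (\<Sum>u<b ^ 1. \<Sum>u'<b ^ 1. emeasure lborel {0..<1::real})"
      unfolding pair_measure_sum_def by (intro sum_mono emeasure_mono) auto
    also have "\<dots> = ennreal (real b * real b * 1)" 
      by (simp add: ennreal_of_nat_eq_real_of_nat flip: ennreal_mult)
    also have "\<dots> \<le> ennreal (real b * real b * (C * \<rho> + 1))"
      using C base b by (intro ennreal_leI mult_left_mono) auto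
    finally show ?case using b by simp
  next
    case (Suc m)
    have "pair_measure_sum (Suc m) \<rho>
       \<le> of_nat (b ^ m) * of_nat (b ^ m) * of_nat b * of_nat b * ennreal (c * \<rho>)
          + of_nat b * pair_measure_sum m (\<rho> / \<gamma>)"
      using Suc by (intro pair_measure_sum_Suc diff) auto
    also have "\<dots> \<le> of_nat (b ^ m) * of_nat (b ^ m) * of_nat b * of_nat b * ennreal (c * \<rho>)
          + of_nat b * ennreal (real b ^ m * real b ^ m * (C * (\<rho> / \<gamma>) + real b / real b ^ m))"
      using Suc.prems gamma_pos by (intro add_left_mono mult_left_mono Suc.IH) auto
    also have "\<dots> = ennreal (real b ^ m * real b ^ m * real b * real b * (c * \<rho>)
          + real b * (real b ^ m * real b ^ m * (C * (\<rho> / \<gamma>) + real b / real b ^ m)))"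
      using Suc.prems c C gamma_pos b_pos
      by (simp add: ennreal_of_nat_eq_real_of_nat ennreal_plus ennreal_mult)
    also have "real b ^ m * real b ^ m * real b * real b * (c * \<rho>)
          + real b * (real b ^ m * real b ^ m * (C * (\<rho> / \<gamma>) + real b / real b ^ m))
        = real b ^ Suc m * real b ^ Suc m * (C * \<rho> + real b / real b ^ Suc m)"
    proof -
      have "1 / \<gamma> = real b * lam" using b_gamma gamma_pos by (simp add: field_simps)
      then have "C * (\<rho> / \<gamma>) = real b * (lam * C * \<rho>)"
        by (metis (no_types, opaque_lifting) mult.commute mult.left_commute times_divide_eq_right mult_1)
      moreover have "c + lam * C = C" using lam by (simp add: C_def field_simps)
      then have "C * \<rho> = c * \<rho> + lam * C * \<rho>" by (metis distrib_right)
      ultimately show ?thesis using b_pos by (simp add: field_simps)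
    qed
    finally show ?case .
  qed
  then show ?thesis using that C by blast
qed

end

section \<open>Digits and the self-similarity of Theta\<close>

text \<open>
  Least significant digit first, so that \<open>x_seq b \<xi> x n = (x + word b n \<xi>) / b ^ n\<close> and, for
  \<open>n \<le> m\<close>, \<open>word b n \<xi>\<close> may be replaced by \<open>word b m \<xi>\<close> modulo 1.
\<close>

definition word :: "nat \<Rightarrow> nat \<Rightarrow> real \<Rightarrow> nat" where
  "word b n \<xi> = (\<Sum>i<n. digit b (xi_seq b \<xi> i) * b ^ i)"

lemma xi_seq_0 [simp]: "xi_seq b \<xi> 0 = \<xi>"
  by (simp add: xi_seq_def)

lemma xi_seq_add: "xi_seq b \<xi> (n + m) = xi_seq b (xi_seq b \<xi> n) m"
  by (simp add: xi_seq_def funpow_add add.commute[of n m])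

lemma tau_in_unit: "tau b \<xi> \<in> {0..<1}"
  by (simp add: tau_def frac_lt_1)

lemma xi_seq_in_unit: "\<xi> \<in> {0..<1} \<Longrightarrow> xi_seq b \<xi> n \<in> {0..<1}"
  by (cases n) (use tau_in_unit in \<open>auto simp: xi_seq_def\<close>)

lemma digit_less:
  assumes "0 < b" "\<xi> \<in> {0..<1}"
  shows "digit b \<xi> < b"
proof -
  have "real b * \<xi> < real b" using assms by simp
  then have "\<lfloor>real b * \<xi>\<rfloor> < int b" by (simp add: floor_less_iff)
  then show ?thesis using assms by (simp add: digit_def nat_less_iff)
qed

lemma tau_plus_digit:
  assumes "\<xi> \<in> {0..<1}"
  shows "tau b \<xi> + real (digit b \<xi>) = real b * \<xi>"
  using assms by (simp add: tau_def digit_def frac_def)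

lemma word_0 [simp]: "word b 0 \<xi> = 0"
  by (simp add: word_def)

lemma word_add: "word b (n + m) \<xi> = word b n \<xi> + b ^ n * word b m (xi_seq b \<xi> n)"
proof -
  have "word b (n + m) \<xi> = word b n \<xi> + (\<Sum>i<m. digit b (xi_seq b \<xi> (n + i)) * b ^ (n + i))"
    unfolding word_def by (induction m) (simp_all add: add.assoc)
  then show ?thesis
    by (simp add: word_def xi_seq_add sum_distrib_left power_add mult_ac)
qed

lemma word_Suc: "word b (Suc n) \<xi> = digit b \<xi> + b * word b n (tau b \<xi>)"
  using word_add[of b 1 n \<xi>] by (simp add: word_def xi_seq_def)

lemma word_less:
  assumes "0 < b" "\<xi> \<in> {0..<1}"
  shows "word b n \<xi> < b ^ n"
  using assms(2)
proof (induction n arbitrary: \<xi>)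
  case (Suc n)
  have "Suc (word b n (tau b \<xi>)) \<le> b ^ n" using Suc.IH[OF tau_in_unit, of b \<xi>] by simp
  then have "b * Suc (word b n (tau b \<xi>)) \<le> b * b ^ n" by (rule mult_le_mono2)
  then show ?case using digit_less[OF assms(1) Suc.prems] by (simp add: word_Suc)
qed simp

lemma word_split:
  assumes "0 < b" "\<xi> \<in> {0..<1}"
  shows "word b (n + m) \<xi> mod b ^ n = word b n \<xi>"
    "word b (n + m) \<xi> div b ^ n = word b m (xi_seq b \<xi> n)"
  using word_less[OF assms, of n] assms(1) by (simp_all add: word_add)

text \<open>Prescribing one more digit in front applies an inverse branch of \<open>tau\<close>,
  which shrinks the enclosing interval by the factor \<open>b\<close>.\<close>

lemma word_level_set_subset:
  assumes b: "0 < b"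
  shows "\<exists>c. {\<xi>\<in>{0..<1}. word b n \<xi> = w} \<subseteq> {c..<c + 1 / real b ^ n}"
proof (induction n arbitrary: w)
  case 0
  show ?case by (intro exI[of _ 0]) auto
next
  case (Suc n)
  obtain c where c: "{\<xi>\<in>{0..<1}. word b n \<xi> = w div b} \<subseteq> {c..<c + 1 / real b ^ n}"
    using Suc.IH by blast
  have "\<xi> \<in> {(real (w mod b) + c) / real b..<(real (w mod b) + c) / real b + 1 / real b ^ Suc n}"
    if xi: "\<xi> \<in> {0..<1}" and w: "word b (Suc n) \<xi> = w" for \<xi>
  proof -
    have d: "digit b \<xi> = w mod b" "word b n (tau b \<xi>) = w div b"
      using digit_less[OF b xi] b by (simp_all add: word_Suc flip: w)
    then have "tau b \<xi> \<in> {c..<c + 1 / real b ^ n}" using c tau_in_unit by blast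
    moreover have "\<xi> = (real (w mod b) + tau b \<xi>) / real b"
      using tau_plus_digit[OF xi, of b] b by (simp add: d(1) field_simps)
    moreover have "(real (w mod b) + (c + 1 / real b ^ n)) / real b = (real (w mod b) + c) / real b + 1 / real b ^ Suc n"
      by (simp add: add_divide_distrib)
    ultimately show ?thesis
      using b by (metis add_le_cancel_left add_less_cancel_left atLeastLessThan_iff divide_right_mono divide_strict_right_mono of_nat_0_le_iff of_nat_0_less_iff)
  qed
  then show ?case by blast
qed

lemma emeasure_word_level_set:
  assumes "0 < b"
  shows "emeasure lborel {\<xi>\<in>{0..<1}. word b n \<xi> = w} \<le> ennreal (1 / real b ^ n)"
proof -
  obtain c where c: "{\<xi>\<in>{0..<1}. word b n \<xi> = w} \<subseteq> {c..<c + 1 / real b ^ n}"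
    using word_level_set_subset[OF assms] by blast
  then have "emeasure lborel {\<xi>\<in>{0..<1}. word b n \<xi> = w} \<le> emeasure lborel {c..<c + 1 / real b ^ n}"
    by (intro emeasure_mono) auto
  then show ?thesis by simp
qed

lemma tau_measurable [measurable]: "tau b \<in> borel_measurable borel"
  unfolding tau_def[abs_def] frac_def by measurable

lemma digit_measurable [measurable]: "digit b \<in> borel \<rightarrow>\<^sub>M count_space UNIV"
  unfolding digit_def[abs_def] by measurable

lemma xi_seq_measurable [measurable]: "(\<lambda>\<xi>. xi_seq b \<xi> n) \<in> borel_measurable borel"
proof (induction n)
  case (Suc n)
  have "(\<lambda>\<xi>. xi_seq b \<xi> (Suc n)) = (\<lambda>\<xi>. tau b (xi_seq b \<xi> n))" by (simp add: xi_seq_def)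
  then show ?case using Suc by simp
qed simp

lemma word_measurable [measurable]: "word b n \<in> borel \<rightarrow>\<^sub>M count_space UNIV"
  unfolding word_def[abs_def] by measurable

lemma x_seq_word:
  assumes "0 < b"
  shows "x_seq b \<xi> x n = (x + real (word b n \<xi>)) / real b ^ n"
proof -
  have "(\<Sum>i<n. real (digit b (xi_seq b \<xi> i)) / real b ^ (n - i)) = (\<Sum>i<n. real (digit b (xi_seq b \<xi> i)) * real b ^ i) / real b ^ n"
    unfolding sum_divide_distrib using assms
    by (intro sum.cong refl) (simp add: power_diff)
  then show ?thesis by (simp add: x_seq_def word_def add_divide_distrib)
qed

lemma x_seq_add: "x_seq b \<xi> x (n + m) = x_seq b (xi_seq b \<xi> n) (x_seq b \<xi> x n) m"
proof -
  have "(baker b ^^ (m + n)) (\<xi>, x) = (baker b ^^ m) ((baker b ^^ n) (\<xi>, x))" by (simp add: funpow_add)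
  then show ?thesis unfolding baker_iterate by (simp add: add.commute)
qed

text \<open>The difference is \<open>2 / t\<close> times the error of \<open>sin v\<close> against
  \<open>v\<close> at \<open>v = pi * t\<close>, and that error is at most \<open>v^2\<close>. A
  rate linear in \<open>t\<close> suffices, as the parameter decays geometrically along the
  orbit.\<close>

lemma abs_s_fun_diff_le: "\<bar>s_fun t - 2 * pi\<bar> \<le> 2 * pi^2 * \<bar>t\<bar>"
proof (cases "t = 0")
  case False
  have bound: "\<bar>sin v - v\<bar> \<le> \<bar>v\<bar> * \<bar>v\<bar>" for v :: real
  proof -
    have pos: "\<bar>sin v - v\<bar> \<le> v * v" if "0 < v" for v :: real
    proof -
      have "\<exists>z. 0 < z \<and> z < v \<and> (sin v - v) - (sin 0 - 0) = (v - 0) * (cos z - 1)"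
        using that by (intro MVT2) (auto intro!: derivative_eq_intros)
      then obtain z where z: "0 < z" "z < v" "sin v - v = v * (cos z - 1)" by auto
      have "\<bar>cos z - cos 0\<bar> \<le> \<bar>z - 0\<bar>" by (rule abs_cos_diff_le)
      then have "v * \<bar>cos z - 1\<bar> \<le> v * v" using z by (intro mult_left_mono) auto
      then show ?thesis using that unfolding z(3) abs_mult by simp
    qed
    show ?thesis
    proof (cases "v = 0")
      case False
      then consider "0 < v" | "0 < - v" by linarith
      then show ?thesis using pos[of v] pos[of "- v"] by cases auto
    qed simp
  qed
  have "s_fun t - 2 * pi = (sin (pi * t) - pi * t) * (2 / t)"
    using False by (simp add: s_fun_def field_simps)
  then have "\<bar>s_fun t - 2 * pi\<bar> = \<bar>sin (pi * t) - pi * t\<bar> * (2 / \<bar>t\<bar>)" by (simp only: abs_mult abs_divide abs_numeral)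
  also have "\<dots> \<le> (\<bar>pi * t\<bar> * \<bar>pi * t\<bar>) * (2 / \<bar>t\<bar>)"
    by (intro mult_right_mono bound) auto
  also have "\<dots> = 2 * pi^2 * \<bar>t\<bar>" using False by (simp add: abs_mult power2_eq_square)
  finally show ?thesis .
qed (simp add: s_fun_def)

lemma abs_s_fun_le: "\<bar>s_fun t\<bar> \<le> 2 * pi"
proof (cases "t = 0")
  case False
  have "\<bar>sin (pi * t)\<bar> \<le> \<bar>pi * t\<bar>" by (rule abs_sin_x_le_abs_x)
  then show ?thesis using False by (simp add: s_fun_def abs_mult divide_le_eq field_simps)
qed (simp add: s_fun_def)

lemma s_fun_measurable [measurable]: "s_fun \<in> borel_measurable borel"
  unfolding s_fun_def[abs_def] by measurable

context weierstrass
begin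

definition theta_term :: "real \<Rightarrow> real \<Rightarrow> real \<Rightarrow> nat \<Rightarrow> real" where
  "theta_term z \<xi> x n = \<gamma> ^ Suc n * s_fun (z / real b ^ Suc n)
    * sin (2 * pi * (x_seq b \<xi> x (Suc n) + z / (2 * real b ^ Suc n)))"

lemma Theta_eq: "Theta b \<gamma> z (\<xi>, x) = (\<Sum>n. theta_term z \<xi> x n)"
  by (simp add: Theta_def theta_term_def)

lemma abs_theta_term_le: "\<bar>theta_term z \<xi> x n\<bar> \<le> 2 * pi * \<gamma> * \<gamma> ^ n"
proof -
  have "\<bar>theta_term z \<xi> x n\<bar> = \<gamma> ^ Suc n * (\<bar>s_fun (z / real b ^ Suc n)\<bar>
      * \<bar>sin (2 * pi * (x_seq b \<xi> x (Suc n) + z / (2 * real b ^ Suc n)))\<bar>)"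
    using gamma_pos by (simp add: theta_term_def abs_mult)
  also have "\<dots> \<le> \<gamma> ^ Suc n * (2 * pi * 1)"
    using gamma_pos by (intro mult_left_mono mult_mono abs_s_fun_le) auto
  finally show ?thesis by (simp add: mult_ac)
qed

lemma summable_geometric_gamma: "summable (\<lambda>n. 2 * pi * \<gamma> * \<gamma> ^ n)"
  using gamma_pos gamma_less_1 by (intro summable_mult summable_geometric) auto

lemma summable_theta_term: "summable (theta_term z \<xi> x)"
  by (rule summable_comparison_test'[OF summable_geometric_gamma, of 0]) (use abs_theta_term_le in auto)

lemma abs_Theta_le: "\<bar>Theta b \<gamma> z (\<xi>, x)\<bar> \<le> 2 * pi * \<gamma> / (1 - \<gamma>)"
proof -
  have s: "summable (\<lambda>n. \<bar>theta_term z \<xi> x n\<bar>)"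
    by (rule summable_comparison_test'[OF summable_geometric_gamma, of 0]) (use abs_theta_term_le in auto)
  have "\<bar>Theta b \<gamma> z (\<xi>, x)\<bar> \<le> (\<Sum>n. \<bar>theta_term z \<xi> x n\<bar>)"
    unfolding Theta_eq by (rule summable_rabs[OF s])
  also have "\<dots> \<le> (\<Sum>n. 2 * pi * \<gamma> * \<gamma> ^ n)"
    by (intro suminf_le abs_theta_term_le s summable_geometric_gamma)
  also have "\<dots> = 2 * pi * \<gamma> / (1 - \<gamma>)"
    using gamma_pos gamma_less_1 by (simp add: suminf_mult suminf_geometric)
  finally show ?thesis .
qed

definition theta_head :: "real \<Rightarrow> nat \<Rightarrow> real \<Rightarrow> real" where
  "theta_head z N y = (\<Sum>n<N. \<gamma> ^ Suc n * s_fun (z / real b ^ Suc n)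
    * sin (2 * pi * ((y + z / 2) / real b ^ Suc n)))"

lemma theta_term_word:
  assumes "n < N"
  shows "theta_term z \<xi> x n = \<gamma> ^ Suc n * s_fun (z / real b ^ Suc n)
    * sin (2 * pi * ((x + real (word b N \<xi>) + z / 2) / real b ^ Suc n))"
proof -
  obtain j where j: "N = Suc n + j" using assms by (metis add_Suc less_iff_Suc_add)
  define k where "k = word b j (xi_seq b \<xi> (Suc n))"
  have "real (word b N \<xi>) = real (word b (Suc n) \<xi>) + real b ^ Suc n * real k"
    unfolding j word_add k_def by simp
  then have "(x + real (word b N \<xi>) + z / 2) / real b ^ Suc n
      = x_seq b \<xi> x (Suc n) + z / (2 * real b ^ Suc n) + real k"
    using b_pos by (simp add: x_seq_word field_simps)
  then have "sin (2 * pi * ((x + real (word b N \<xi>) + z / 2) / real b ^ Suc n))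
     = sin (2 * pi * (x_seq b \<xi> x (Suc n) + z / (2 * real b ^ Suc n)))"
    by (simp only: sin_2pi_add_nat)
  then show ?thesis by (simp add: theta_term_def)
qed

text \<open>Self-similarity under the baker map. The head sees \<xi> only through its first
  \<open>N\<close> digits, so for points sharing these and \<open>x\<close> the values differ by
  \<open>\<gamma> ^ N\<close> times a difference taken at a common new base point, with the smaller
  parameter \<open>z / b ^ N\<close>.\<close>

lemma Theta_split:
  "Theta b \<gamma> z (\<xi>, x) = theta_head z N (x + real (word b N \<xi>))
    + \<gamma> ^ N * Theta b \<gamma> (z / real b ^ N) (xi_seq b \<xi> N, x_seq b \<xi> x N)"
proof -
  have "theta_term z \<xi> x (n + N) = \<gamma> ^ N * theta_term (z / real b ^ N) (xi_seq b \<xi> N) (x_seq b \<xi> x N) n" for n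
    using x_seq_add[of b \<xi> x N "Suc n"]
    by (simp add: theta_term_def power_add mult_ac add.commute add.left_commute)
  then have "(\<Sum>n. theta_term z \<xi> x (n + N)) = \<gamma> ^ N * Theta b \<gamma> (z / real b ^ N) (xi_seq b \<xi> N, x_seq b \<xi> x N)"
    by (simp add: Theta_eq suminf_mult summable_theta_term)
  moreover have "(\<Sum>n<N. theta_term z \<xi> x n) = theta_head z N (x + real (word b N \<xi>))"
    unfolding theta_head_def by (intro sum.cong refl theta_term_word) auto
  ultimately show ?thesis
    unfolding Theta_eq using suminf_split_initial_segment[OF summable_theta_term, of z \<xi> x N] by simp
qed

lemma Theta_measurable [measurable]: "Theta b \<gamma> z \<in> borel_measurable borel"
proof -
  have [measurable]: "(\<lambda>p. x_seq b (fst p) (snd p) n) \<in> borel_measurable (borel :: (real \<times> real) measure)" for n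
    unfolding x_seq_def borel_prod[symmetric] by measurable
  have "(\<lambda>p. theta_term z (fst p) (snd p) n) \<in> borel_measurable (borel :: (real \<times> real) measure)" for n
    unfolding theta_term_def by measurable
  then have "(\<lambda>p. \<Sum>n. theta_term z (fst p) (snd p) n) \<in> borel_measurable (borel :: (real \<times> real) measure)"
    by (rule borel_measurable_suminf)
  moreover have "Theta b \<gamma> z = (\<lambda>p. \<Sum>n. theta_term z (fst p) (snd p) n)"
    by (auto simp: Theta_eq)
  ultimately show ?thesis by simp
qed

end

section \<open>Crowded words and the counting of blocks\<close>

context weierstrass
begin

section \<open>Approximation of \<open>Theta\<close> by \<open>wave\<close>, and sparse
  words\<close>

lemma inverse_b_power_le_gamma_power: "1 / real b ^ m \<le> \<gamma> ^ m"
  using power_mono[of "1 / real b" \<gamma> m] inverse_b_less_gamma by (simp add: power_divide)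

text \<open>Each level contributes \<open>2 * pi^2\<close> from replacing \<open>s_fun\<close> by
  \<open>2 * pi\<close> and another \<open>2 * pi^2\<close> from dropping the shift
  \<open>z / 2\<close> in the phase; \<open>\<gamma> / (1 - \<gamma>)\<close> sums the levels. The
  constant also dominates the supremum bound for \<open>Theta\<close>, which controls the tail in
  \<open>Theta_approx\<close>.\<close>

definition approx_const :: real where
  "approx_const = 4 * pi^2 * \<gamma> / (1 - \<gamma>)"

lemma approx_const_pos: "0 < approx_const"
  using gamma_pos gamma_less_1 by (simp add: approx_const_def)

lemma theta_head_approx: "\<bar>theta_head z m y - wave m y\<bar> \<le> approx_const * \<bar>z\<bar>"
proof -
  have "\<bar>theta_head z m y - wave m y\<bar> \<le> (\<Sum>n<m. (4 * pi^2 * \<bar>z\<bar> * \<gamma>) * \<gamma> ^ n)"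
    unfolding theta_head_def wave_def sum_subtractf[symmetric]
  proof (rule order.trans[OF sum_abs sum_mono])
    fix n
    let ?B = "real b ^ Suc n"
    let ?s = "s_fun (z / ?B)" and ?p = "sin (2 * pi * ((y + z / 2) / ?B))" and ?q = "sin (2 * pi * (y / ?B))"
    have B: "1 \<le> ?B" using b_pos by (intro one_le_power) simp
    then have "\<bar>z\<bar> / ?B \<le> \<bar>z\<bar> / 1" using b_pos by (intro divide_left_mono) auto
    then have zB: "\<bar>z\<bar> / ?B \<le> \<bar>z\<bar>" by simp
    have "\<bar>?s - 2 * pi\<bar> \<le> 2 * pi^2 * \<bar>z / ?B\<bar>" by (rule abs_s_fun_diff_le)
    also have "\<bar>z / ?B\<bar> = \<bar>z\<bar> / ?B" using b_pos by simp
    finally have 1: "\<bar>?s - 2 * pi\<bar> \<le> 2 * pi^2 * \<bar>z\<bar>"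
      using zB by (smt (verit) mult_left_mono zero_le_power2)
    have "\<bar>?p - ?q\<bar> \<le> \<bar>2 * pi * ((y + z / 2) / ?B) - 2 * pi * (y / ?B)\<bar>" by (rule abs_sin_diff_le)
    also have "2 * pi * ((y + z / 2) / ?B) - 2 * pi * (y / ?B) = pi * (z / ?B)"
      by (simp add: add_divide_distrib ring_distribs)
    also have "\<bar>pi * (z / ?B)\<bar> = pi * (\<bar>z\<bar> / ?B)" using b_pos by (simp add: abs_mult)
    also have "\<dots> \<le> pi * \<bar>z\<bar>" using zB by (intro mult_left_mono) auto
    finally have 2: "\<bar>?p - ?q\<bar> \<le> pi * \<bar>z\<bar>" .
    have "\<gamma> ^ Suc n * ?s * ?p - \<gamma> ^ Suc n * (2 * pi) * ?q = \<gamma> ^ Suc n * ((?s - 2 * pi) * ?p + 2 * pi * (?p - ?q))"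
      by (simp add: algebra_simps)
    also have "\<bar>\<dots>\<bar> = \<gamma> ^ Suc n * \<bar>(?s - 2 * pi) * ?p + 2 * pi * (?p - ?q)\<bar>"
      using gamma_pos by (simp add: abs_mult)
    also have "\<dots> \<le> \<gamma> ^ Suc n * (\<bar>?s - 2 * pi\<bar> * \<bar>?p\<bar> + 2 * pi * \<bar>?p - ?q\<bar>)"
      using gamma_pos by (intro mult_left_mono order.trans[OF abs_triangle_ineq]) (auto simp: abs_mult)
    also have "\<dots> \<le> \<gamma> ^ Suc n * (2 * pi^2 * \<bar>z\<bar> * 1 + 2 * pi * (pi * \<bar>z\<bar>))"
      using gamma_pos 1 2 by (intro mult_left_mono add_mono mult_mono) auto
    also have "\<dots> = (4 * pi^2 * \<bar>z\<bar> * \<gamma>) * \<gamma> ^ n" by (simp add: power2_eq_square algebra_simps)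
    finally show "\<bar>\<gamma> ^ Suc n * ?s * ?p - \<gamma> ^ Suc n * (2 * pi) * ?q\<bar> \<le> (4 * pi^2 * \<bar>z\<bar> * \<gamma>) * \<gamma> ^ n" .
  qed
  also have "\<dots> = (4 * pi^2 * \<bar>z\<bar> * \<gamma>) * (\<Sum>n<m. \<gamma> ^ n)" by (simp add: sum_distrib_left)
  also have "\<dots> \<le> (4 * pi^2 * \<bar>z\<bar> * \<gamma>) * (1 / (1 - \<gamma>))"
    using sum_power_interval_le[of \<gamma> 0 m] gamma_pos gamma_less_1
    by (intro mult_left_mono) (auto simp: lessThan_atLeast0)
  finally show ?thesis by (simp add: approx_const_def mult_ac)
qed

lemma Theta_approx:
  "\<bar>Theta b \<gamma> z (\<xi>, x) - wave m (x + real (word b m \<xi>))\<bar> \<le> approx_const * (\<bar>z\<bar> + \<gamma> ^ m)"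
proof -
  have "2 * pi * \<gamma> / (1 - \<gamma>) \<le> approx_const"
    unfolding approx_const_def using gamma_pos gamma_less_1 pi_ge_two
    by (intro divide_right_mono mult_right_mono) (auto simp: power2_eq_square)
  then have "\<gamma> ^ m * \<bar>Theta b \<gamma> (z / real b ^ m) (xi_seq b \<xi> m, x_seq b \<xi> x m)\<bar> \<le> \<gamma> ^ m * approx_const"
    using gamma_pos by (intro mult_left_mono order.trans[OF abs_Theta_le]) auto
  moreover have "\<bar>\<gamma> ^ m * Theta b \<gamma> (z / real b ^ m) (xi_seq b \<xi> m, x_seq b \<xi> x m)\<bar>
      = \<gamma> ^ m * \<bar>Theta b \<gamma> (z / real b ^ m) (xi_seq b \<xi> m, x_seq b \<xi> x m)\<bar>"
    using gamma_pos by (simp add: abs_mult)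
  moreover have "approx_const * (\<bar>z\<bar> + \<gamma> ^ m) = approx_const * \<bar>z\<bar> + \<gamma> ^ m * approx_const"
    by (simp add: algebra_simps)
  ultimately show ?thesis
    using theta_head_approx[of z m "x + real (word b m \<xi>)"] Theta_split[of z \<xi> x m] by linarith
qed

text \<open>
  A word is crowded at \<open>y\<close> if its wave value has more than \<open>mass_bound\<close> neighbours at scale
  \<open>c \<gamma> ^ m\<close>, counting among all \<open>b ^ m\<close> words of the same length.
\<close>

definition mass_bound :: "real \<Rightarrow> nat \<Rightarrow> real" where
  "mass_bound \<eta> m = real b ^ m * (\<gamma> ^ m) powr (1 - \<eta>)"

definition crowded :: "real \<Rightarrow> real \<Rightarrow> nat \<Rightarrow> nat \<Rightarrow> real set" where
  "crowded c \<eta> m u = {y. mass_bound \<eta> m < (\<Sum>u'<b ^ m. indicator (wave_close m (c * \<gamma> ^ m) u u') y)}"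

lemma crowded_measurable [measurable]: "crowded c \<eta> m u \<in> sets borel"
  unfolding crowded_def by measurable

lemma mass_bound_pos: "0 < mass_bound \<eta> m"
  using b_pos gamma_pos by (simp add: mass_bound_def)

lemma crowded_Markov:
  "ennreal (mass_bound \<eta> m) * emeasure lborel (crowded c \<eta> m u \<inter> {0..<1})
    \<le> (\<Sum>u'<b ^ m. emeasure lborel (wave_close m (c * \<gamma> ^ m) u u' \<inter> {0..<1}))"
proof -
  have "ennreal (mass_bound \<eta> m) * emeasure lborel (crowded c \<eta> m u \<inter> {0..<1})
     = (\<integral>\<^sup>+ y. ennreal (mass_bound \<eta> m) * indicator (crowded c \<eta> m u \<inter> {0..<1}) y \<partial>lborel)"
    by (simp add: nn_integral_cmult_indicator)
  also have "\<dots> \<le> (\<integral>\<^sup>+ y. (\<Sum>u'<b ^ m. indicator (wave_close m (c * \<gamma> ^ m) u u' \<inter> {0..<1}) y) \<partial>lborel)"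
  proof (rule nn_integral_mono)
    fix y :: real
    let ?W = "wave_close m (c * \<gamma> ^ m) u"
    show "ennreal (mass_bound \<eta> m) * indicator (crowded c \<eta> m u \<inter> {0..<1}) y
      \<le> (\<Sum>u'<b ^ m. indicator (?W u' \<inter> {0..<1}) y)"
    proof (cases "y \<in> crowded c \<eta> m u \<inter> {0..<1}")
      case True
      then have "ennreal (mass_bound \<eta> m) \<le> ennreal (\<Sum>u'<b ^ m. indicator (?W u') y)"
        by (intro ennreal_leI) (simp add: crowded_def)
      also have "\<dots> = (\<Sum>u'<b ^ m. ennreal (indicator (?W u') y))"
        by (rule sum_ennreal[symmetric]) simp
      also have "\<dots> = (\<Sum>u'<b ^ m. indicator (?W u' \<inter> {0..<1}) y)"
        using True by (intro sum.cong refl) (auto simp: indicator_def)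
      finally show ?thesis using True by simp
    qed simp
  qed
  also have "\<dots> = (\<Sum>u'<b ^ m. emeasure lborel (wave_close m (c * \<gamma> ^ m) u u' \<inter> {0..<1}))"
    by (subst nn_integral_sum) auto
  finally show ?thesis .
qed

lemma crowded_measure_bound:
  assumes c: "0 < c"
  obtains C where "0 < C" "\<And>(m::nat) \<eta>. 1 \<le> m \<Longrightarrow>
    (\<Sum>u<b ^ m. emeasure lborel (crowded c \<eta> m u \<inter> {0..<1})) \<le> ennreal (real b ^ m * (C * (\<gamma> ^ m) powr \<eta>))"
proof -
  obtain C0 where C0: "0 < C0" "\<And>(m::nat) (\<rho>::real). 1 \<le> m \<Longrightarrow> 0 \<le> \<rho> \<Longrightarrow>
    pair_measure_sum m \<rho> \<le> ennreal (real b ^ m * real b ^ m * (C0 * \<rho> + real b / real b ^ m))"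
    using pair_measure_sum_bound by blast
  define C where "C = C0 * c + real b"
  have C: "0 < C" using C0 c b_pos by (simp add: C_def add_pos_pos)
  have "(\<Sum>u<b ^ m. emeasure lborel (crowded c \<eta> m u \<inter> {0..<1})) \<le> ennreal (real b ^ m * (C * (\<gamma> ^ m) powr \<eta>))"
    (is "?S \<le> _") if m: "1 \<le> m" for m \<eta>
  proof -
    have "ennreal (mass_bound \<eta> m) * ?S \<le> pair_measure_sum m (c * \<gamma> ^ m)"
      unfolding pair_measure_sum_def sum_distrib_left by (intro sum_mono crowded_Markov)
    also have "\<dots> \<le> ennreal (real b ^ m * real b ^ m * (C0 * (c * \<gamma> ^ m) + real b / real b ^ m))"
      using c gamma_pos by (intro C0(2) m) auto
    also have "\<dots> \<le> ennreal (real b ^ m * real b ^ m * (C * \<gamma> ^ m))"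
    proof (intro ennreal_leI mult_left_mono)
      \<comment> \<open>The share of almost identical pairs is absorbed because
        \<open>1 / b < \<gamma>\<close>; both errors are then of order \<open>\<gamma> ^ m\<close>,
        and division by \<open>mass_bound\<close> leaves the power \<eta>.\<close>
      have "real b * (1 / real b ^ m) \<le> real b * \<gamma> ^ m"
        by (intro mult_left_mono inverse_b_power_le_gamma_power) auto
      then show "C0 * (c * \<gamma> ^ m) + real b / real b ^ m \<le> C * \<gamma> ^ m"
        by (simp add: C_def algebra_simps)
    qed auto
    also have "real b ^ m * real b ^ m * (C * \<gamma> ^ m) = mass_bound \<eta> m * (real b ^ m * (C * (\<gamma> ^ m) powr \<eta>))"
    proof -
      have "(\<gamma> ^ m) powr (1 - \<eta>) * (\<gamma> ^ m) powr \<eta> = \<gamma> ^ m"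
        using gamma_pos by (simp flip: powr_add)
      then show ?thesis unfolding mass_bound_def by (metis mult.assoc mult.commute)
    qed
    also have "ennreal \<dots> = ennreal (mass_bound \<eta> m) * ennreal (real b ^ m * (C * (\<gamma> ^ m) powr \<eta>))"
      using mass_bound_pos by (intro ennreal_mult') (simp add: less_imp_le)
    finally show ?thesis
      using mass_bound_pos[of \<eta> m] by (subst (asm) ennreal_mult_le_mult_iff) (auto simp: ennreal_eq_0_iff)
  qed
  then show ?thesis using that C by blast
qed

section \<open>Exceptional points in the square and the counting of digit words\<close>

definition crowded_at :: "real \<Rightarrow> real \<Rightarrow> nat \<Rightarrow> nat \<Rightarrow> (real \<times> real) set" where
  "crowded_at c \<eta> m n = {(\<xi>, x) \<in> unit_square. x_seq b \<xi> x n \<in> crowded c \<eta> m (word b m (xi_seq b \<xi> n))}"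

lemma unit_square_measurable [measurable]: "unit_square \<in> sets borel"
  unfolding unit_square_def by (intro borel_Times) auto

lemma x_seq_measurable [measurable]:
  "(\<lambda>p. x_seq b (fst p) (snd p) n) \<in> borel_measurable (borel :: (real \<times> real) measure)"
  unfolding x_seq_def borel_prod[symmetric] by measurable

lemma crowded_at_measurable [measurable]: "crowded_at c \<eta> m n \<in> sets borel"
proof -
  have [measurable]: "fst \<in> borel_measurable (borel :: (real \<times> real) measure)"
    unfolding borel_prod[symmetric] by measurable
  have "crowded_at c \<eta> m n = (\<Union>u. unit_square \<inter>
      {p. word b m (xi_seq b (fst p) n) = u} \<inter> {p. x_seq b (fst p) (snd p) n \<in> crowded c \<eta> m u})"
    by (auto simp: crowded_at_def)
  also have "\<dots> \<in> sets borel"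
    by (intro sets.countable_UN image_subsetI sets.Int) measurable
  finally show ?thesis .
qed

text \<open>In effect this is invariance of Lebesgue measure under the baker map. The first
  \<open>n\<close> digits send \<open>x\<close> through all branches \<open>(x + v) / b ^ n\<close>,
  which tile the unit interval, the next \<open>m\<close> digits run over all words, and every
  cylinder has measure at most \<open>1 / b ^ (n + m)\<close>. Hence the bound is the same for all
  \<open>n\<close>.\<close>

lemma crowded_at_measure_bound:
  assumes C: "(\<Sum>u<b ^ m. emeasure lborel (crowded c \<eta> m u \<inter> {0..<1})) \<le> ennreal (real b ^ m * D)"
    and D: "0 \<le> D"
  shows "emeasure lborel (crowded_at c \<eta> m n) \<le> ennreal D"
proof -
  have b0: "0 < b" using b by simp
  let ?W = "\<lambda>w. {\<xi>\<in>{0..<1}. word b (n + m) \<xi> = w}"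
  let ?X = "\<lambda>v u. {x\<in>{0..<1}. (x + real v) / real (b ^ n) \<in> crowded c \<eta> m u}"
  have "crowded_at c \<eta> m n \<subseteq> (\<Union>w<b ^ (n + m). ?W w \<times> ?X (w mod b ^ n) (w div b ^ n))"
  proof
    fix p assume "p \<in> crowded_at c \<eta> m n"
    then obtain \<xi> x where p: "p = (\<xi>, x)" "\<xi> \<in> {0..<1}" "x \<in> {0..<1}"
      "x_seq b \<xi> x n \<in> crowded c \<eta> m (word b m (xi_seq b \<xi> n))"
      by (auto simp: crowded_at_def unit_square_def)
    then show "p \<in> (\<Union>w<b ^ (n + m). ?W w \<times> ?X (w mod b ^ n) (w div b ^ n))"
      using word_less[OF b0 p(2), of "n + m"] word_split[OF b0 p(2)] x_seq_word[OF b0]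
      by (intro UN_I[of "word b (n + m) \<xi>"]) auto
  qed
  then have "emeasure lborel (crowded_at c \<eta> m n) \<le> emeasure lborel (\<Union>w<b ^ (n + m). ?W w \<times> ?X (w mod b ^ n) (w div b ^ n))"
    by (intro emeasure_mono) (auto intro!: borel_Times)
  also have "\<dots> \<le> (\<Sum>w<b ^ (n + m). emeasure lborel (?W w \<times> ?X (w mod b ^ n) (w div b ^ n)))"
    by (intro emeasure_subadditive_finite) (auto intro!: borel_Times)
  also have "\<dots> = (\<Sum>w<b ^ (n + m). emeasure lborel (?W w) * emeasure lborel (?X (w mod b ^ n) (w div b ^ n)))"
    unfolding lborel_prod[symmetric] by (intro sum.cong refl lborel.emeasure_pair_measure_Times) auto
  also have "\<dots> \<le> (\<Sum>w<b ^ (n + m). ennreal (1 / real b ^ (n + m)) * emeasure lborel (?X (w mod b ^ n) (w div b ^ n)))"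
    by (intro sum_mono mult_right_mono emeasure_word_level_set[OF b0]) auto
  also have "\<dots> = ennreal (1 / real b ^ (n + m)) * (\<Sum>w<b ^ n * b ^ m. emeasure lborel (?X (w mod b ^ n) (w div b ^ n)))"
    by (simp only: sum_distrib_left power_add)
  also have "(\<Sum>w<b ^ n * b ^ m. emeasure lborel (?X (w mod b ^ n) (w div b ^ n)))
      = (\<Sum>u<b ^ m. \<Sum>v<b ^ n. emeasure lborel (?X v u))"
    unfolding sum_lessThan_mult using b0 by (intro sum.cong refl) simp
  also have "\<dots> = (\<Sum>u<b ^ m. of_nat (b ^ n) * emeasure lborel (crowded c \<eta> m u \<inter> {0..<1}))"
    using b0 by (intro sum.cong refl emeasure_sum_translates) auto
  also have "ennreal (1 / real b ^ (n + m)) * \<dots> \<le> ennreal (1 / real b ^ (n + m)) * (of_nat (b ^ n) * ennreal (real b ^ m * D))"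
    unfolding sum_distrib_left[symmetric] by (intro mult_left_mono C) auto
  also have "\<dots> = ennreal (1 / real b ^ (n + m) * (real b ^ n * (real b ^ m * D)))"
    using D by (simp add: ennreal_of_nat_eq_real_of_nat flip: ennreal_mult)
  also have "1 / real b ^ (n + m) * (real b ^ n * (real b ^ m * D)) = D"
    using b0 by (simp add: power_add)
  finally show ?thesis .
qed

text \<open>\<open>P\<close> is to be a slice at fixed \<open>x\<close>. Its members sharing the
  first \<open>i * m\<close> digits arrive at the same base point, and their next blocks are all
  close to the block of any one of them. That representative is not crowded, so at most
  \<open>mass_bound\<close> continuations occur.\<close>

lemma card_words_bound:
  assumes P: "P \<subseteq> {0..<1}"
    and sparse: "\<And>i \<xi>. 1 \<le> i \<Longrightarrow> i \<le> M \<Longrightarrow> \<xi> \<in> P \<Longrightarrow>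
      x_seq b \<xi> x (i * m) \<notin> crowded c \<eta> m (word b m (xi_seq b \<xi> (i * m)))"
    and close: "\<And>i \<xi> \<xi>'. 1 \<le> i \<Longrightarrow> i \<le> M \<Longrightarrow> \<xi> \<in> P \<Longrightarrow> \<xi>' \<in> P \<Longrightarrow>
      word b (i * m) \<xi> = word b (i * m) \<xi>' \<Longrightarrow>
      x_seq b \<xi> x (i * m) \<in> wave_close m (c * \<gamma> ^ m)
        (word b m (xi_seq b \<xi> (i * m))) (word b m (xi_seq b \<xi>' (i * m)))"
  shows "i \<le> M \<Longrightarrow> real (card (word b (Suc i * m) ` P)) \<le> real b ^ m * mass_bound \<eta> m ^ i"
proof (induction i)
  case 0
  have "word b m ` P \<subseteq> {..<b ^ m}" using P b by (auto intro!: word_less)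
  then have "card (word b m ` P) \<le> card {..<b ^ m}" by (intro card_mono) auto
  then have "card (word b m ` P) \<le> b ^ m" by simp
  then have "real (card (word b m ` P)) \<le> real (b ^ m)" by (simp only: of_nat_le_iff)
  then show ?case by simp
next
  case (Suc i)
  have b0: "0 < b" using b by simp
  define n where "n = Suc i * m"
  define V where "V = word b n ` P"
  define F where "F v = {word b m (xi_seq b \<xi> n) | \<xi>. \<xi> \<in> P \<and> word b n \<xi> = v}" for v
  have in_unit: "xi_seq b \<xi> n \<in> {0..<1}" if "\<xi> \<in> P" for \<xi>
    using that P by (intro xi_seq_in_unit) auto
  have Fsub: "F v \<subseteq> {..<b ^ m}" for v using in_unit by (auto simp: F_def intro!: word_less b0)
  then have finF: "finite (F v)" for v by (rule finite_subset) simp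
  have "V \<subseteq> {..<b ^ n}" using P b by (auto simp: V_def intro!: word_less)
  then have finV: "finite V" by (rule finite_subset) simp
  have cardF: "real (card (F v)) \<le> mass_bound \<eta> m" if v: "v \<in> V" for v
  proof -
    obtain \<xi> where xi: "\<xi> \<in> P" "v = word b n \<xi>" using v by (auto simp: V_def)
    let ?W = "\<lambda>u'. wave_close m (c * \<gamma> ^ m) (word b m (xi_seq b \<xi> n)) u'"
    have "F v \<subseteq> {u'\<in>{..<b ^ m}. x_seq b \<xi> x n \<in> ?W u'}"
      using close[of "Suc i" \<xi>] xi Suc.prems Fsub by (auto simp: F_def n_def)
    then have "card (F v) \<le> card {u'\<in>{..<b ^ m}. x_seq b \<xi> x n \<in> ?W u'}"
      by (intro card_mono) auto
    then have "real (card (F v)) \<le> real (card {u'\<in>{..<b ^ m}. x_seq b \<xi> x n \<in> ?W u'})" by simp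
    also have "\<dots> = (\<Sum>u'<b ^ m. indicator (?W u') (x_seq b \<xi> x n))"
      by (simp add: indicator_def sum.If_cases Int_def conj_commute)
    also have "\<dots> \<le> mass_bound \<eta> m"
      using sparse[of "Suc i" \<xi>] xi Suc.prems by (auto simp: crowded_def n_def)
    finally show ?thesis .
  qed
  have "word b (Suc (Suc i) * m) ` P \<subseteq> (\<Union>v\<in>V. (\<lambda>u. v + b ^ n * u) ` F v)"
  proof -
    have "word b (Suc (Suc i) * m) \<xi> = word b n \<xi> + b ^ n * word b m (xi_seq b \<xi> n)" for \<xi>
    proof -
      have "Suc (Suc i) * m = n + m" by (simp add: n_def)
      then show ?thesis by (simp only: word_add)
    qed
    then show ?thesis by (auto simp: V_def F_def)
  qed
  then have "card (word b (Suc (Suc i) * m) ` P) \<le> card (\<Union>v\<in>V. (\<lambda>u. v + b ^ n * u) ` F v)"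
    using finV finF by (intro card_mono) auto
  also have "\<dots> \<le> (\<Sum>v\<in>V. card ((\<lambda>u. v + b ^ n * u) ` F v))" by (rule card_UN_le[OF finV])
  also have "\<dots> \<le> (\<Sum>v\<in>V. card (F v))" by (intro sum_mono card_image_le finF)
  finally have "real (card (word b (Suc (Suc i) * m) ` P)) \<le> (\<Sum>v\<in>V. real (card (F v)))"
    by (simp flip: of_nat_sum)
  also have "\<dots> \<le> (\<Sum>v\<in>V. mass_bound \<eta> m)" by (intro sum_mono cardF)
  also have "\<dots> = real (card V) * mass_bound \<eta> m" by simp
  also have "\<dots> \<le> real b ^ m * mass_bound \<eta> m ^ i * mass_bound \<eta> m"
    using Suc.IH Suc.prems mass_bound_pos[of \<eta> m]
    by (intro mult_right_mono) (auto simp: V_def n_def)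
  finally show ?case by (simp add: mult_ac)
qed

lemma emeasure_words_bound:
  assumes P: "P \<subseteq> {0..<1}" and card: "real (card (word b n ` P)) \<le> d"
  shows "emeasure lborel P \<le> ennreal (d / real b ^ n)"
proof -
  have b0: "0 < b" using b by simp
  let ?W = "\<lambda>w. {\<xi>\<in>{0..<1}. word b n \<xi> = w}"
  have "word b n ` P \<subseteq> {..<b ^ n}" using P b0 by (auto intro!: word_less)
  then have fin: "finite (word b n ` P)" by (rule finite_subset) simp
  have "P \<subseteq> (\<Union>w\<in>word b n ` P. ?W w)" using P by blast
  then have "emeasure lborel P \<le> emeasure lborel (\<Union>w\<in>word b n ` P. ?W w)"
    by (rule emeasure_mono) (rule sets.finite_UN[OF fin], simp)
  also have "\<dots> \<le> (\<Sum>w\<in>word b n ` P. emeasure lborel (?W w))"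
    by (intro emeasure_subadditive_finite fin) auto
  also have "\<dots> \<le> (\<Sum>w\<in>word b n ` P. ennreal (1 / real b ^ n))"
    by (intro sum_mono emeasure_word_level_set b0)
  also have "\<dots> = ennreal (real (card (word b n ` P)) * (1 / real b ^ n))"
    by (simp add: ennreal_of_nat_eq_real_of_nat flip: ennreal_mult)
  also have "\<dots> \<le> ennreal (d / real b ^ n)"
    using card b_pos by (intro ennreal_leI) (simp add: divide_right_mono)
  finally show ?thesis .
qed

text \<open>
  The first block of digits is left unrestricted: only from time \<open>m\<close> on is \<open>z / b ^ n\<close> negligible
  at scale \<open>\<gamma> ^ m\<close>.
\<close>

lemma section_measure_bound:
  assumes x: "x \<in> {0..<1}" and z: "\<bar>z\<bar> \<le> 1" and m: "1 \<le> m" and c: "c = 4 * approx_const + 2"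
    and M: "M = 0 \<or> \<rho> \<le> \<gamma> ^ (Suc M * m)"
    and P: "P \<subseteq> {0..<1}"
    and sparse: "\<And>i \<xi>. 1 \<le> i \<Longrightarrow> i \<le> M \<Longrightarrow> \<xi> \<in> P \<Longrightarrow> (\<xi>, x) \<notin> crowded_at c \<eta> m (i * m)"
    and val: "\<And>\<xi>. \<xi> \<in> P \<Longrightarrow> a \<le> Theta b \<gamma> z (\<xi>, x) \<and> Theta b \<gamma> z (\<xi>, x) \<le> a + 2 * \<rho>"
  shows "emeasure lborel P \<le> ennreal ((\<gamma> ^ (m * M)) powr (1 - \<eta>))"
proof -
  have "real (card (word b (Suc M * m) ` P)) \<le> real b ^ m * mass_bound \<eta> m ^ M"
  proof (rule card_words_bound[OF P _ _ order.refl])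
    fix i \<xi> assume i: "1 \<le> i" "i \<le> M" "\<xi> \<in> P"
    then show "x_seq b \<xi> x (i * m) \<notin> crowded c \<eta> m (word b m (xi_seq b \<xi> (i * m)))"
      using sparse[OF i] x P by (auto simp: crowded_at_def unit_square_def)
  next
    fix i \<xi> \<xi>' assume i: "1 \<le> i" "i \<le> M" and xi: "\<xi> \<in> P" "\<xi>' \<in> P"
      and w: "word b (i * m) \<xi> = word b (i * m) \<xi>'"
    define n where "n = i * m"
    define y where "y = x_seq b \<xi> x n"
    have y': "x_seq b \<xi>' x n = y" using w b by (simp add: y_def n_def x_seq_word)
    have \<rho>: "\<rho> \<le> \<gamma> ^ (Suc M * m)" using M i by auto
    define t where "t = Theta b \<gamma> (z / real b ^ n) (xi_seq b \<xi> n, y)"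
    define t' where "t' = Theta b \<gamma> (z / real b ^ n) (xi_seq b \<xi>' n, y)"
    \<comment> \<open>The heads cancel because both points share the first \<open>n\<close>
      digits.\<close>
    have "Theta b \<gamma> z (\<xi>, x) - Theta b \<gamma> z (\<xi>', x) = \<gamma> ^ n * (t - t')"
      using Theta_split[of z \<xi> x n] Theta_split[of z \<xi>' x n] w
      unfolding y' y_def[symmetric] t_def[symmetric] t'_def[symmetric]
      by (simp add: n_def algebra_simps)
    moreover have "\<bar>Theta b \<gamma> z (\<xi>, x) - Theta b \<gamma> z (\<xi>', x)\<bar> \<le> 2 * \<rho>"
      using val[OF xi(1)] val[OF xi(2)] by linarith
    ultimately have "\<gamma> ^ n * \<bar>t - t'\<bar> \<le> 2 * \<rho>" using gamma_pos by (simp add: abs_mult)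
    also have "\<dots> \<le> 2 * \<gamma> ^ (Suc M * m)" using \<rho> by simp
    also have "\<dots> \<le> 2 * \<gamma> ^ (n + m)"
    proof -
      \<comment> \<open>Divided by \<open>\<gamma> ^ n\<close>, the window must still be of size
        \<open>\<gamma> ^ m\<close>, even at the last time \<open>n = M * m\<close>; this is why
        \<rho> is compared with the exponent \<open>Suc M * m\<close>.\<close>
      have "n + m \<le> Suc M * m" using i by (simp add: n_def)
      then show ?thesis using gamma_pos gamma_less_1 by (intro mult_left_mono power_decreasing) auto
    qed
    also have "\<dots> = \<gamma> ^ n * (2 * \<gamma> ^ m)" by (simp add: power_add)
    finally have tt: "\<bar>t - t'\<bar> \<le> 2 * \<gamma> ^ m" using gamma_pos by simp
    have "\<bar>z / real b ^ n\<bar> \<le> 1 / real b ^ n" using z b_pos by (simp add: divide_right_mono)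
    also have "\<dots> \<le> \<gamma> ^ n" by (rule inverse_b_power_le_gamma_power)
    also have "\<dots> \<le> \<gamma> ^ m" using i gamma_pos gamma_less_1 by (intro power_decreasing) (auto simp: n_def)
    finally have "approx_const * (\<bar>z / real b ^ n\<bar> + \<gamma> ^ m) \<le> approx_const * (2 * \<gamma> ^ m)"
      using approx_const_pos by (intro mult_left_mono) auto
    then have approx: "\<bar>Theta b \<gamma> (z / real b ^ n) (\<zeta>, y) - wave m (y + real (word b m \<zeta>))\<bar> \<le> 2 * (approx_const * \<gamma> ^ m)" for \<zeta>
      using Theta_approx[of "z / real b ^ n" \<zeta> y m] by linarith
    \<comment> \<open>Two approximations at \<open>2 * approx_const\<close> each and the
      \<open>2\<close> from \<open>tt\<close> add up to \<open>c\<close>.\<close>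
    have "\<bar>wave m (y + real (word b m (xi_seq b \<xi> n))) - wave m (y + real (word b m (xi_seq b \<xi>' n)))\<bar> \<le> c * \<gamma> ^ m"
      using approx[of "xi_seq b \<xi> n"] approx[of "xi_seq b \<xi>' n"] tt
      unfolding t_def t'_def c distrib_right by linarith
    then show "x_seq b \<xi> x (i * m) \<in> wave_close m (c * \<gamma> ^ m)
        (word b m (xi_seq b \<xi> (i * m))) (word b m (xi_seq b \<xi>' (i * m)))"
      by (simp add: wave_close_def y_def n_def)
  qed
  from emeasure_words_bound[OF P this] show ?thesis
  proof (rule order.trans[OF _ ennreal_leI])
    \<comment> \<open>The powers of \<open>b\<close> cancel against the length of the cylinders. The
      free first block leaves nothing, and each of the other \<open>M\<close> blocks leaves
      \<open>(\<gamma> ^ m) powr (1 - \<eta>)\<close>.\<close>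
    have "real b ^ m * mass_bound \<eta> m ^ M / real b ^ (Suc M * m) = ((\<gamma> ^ m) powr (1 - \<eta>)) ^ M"
      using b_pos by (simp add: mass_bound_def power_mult_distrib power_add power_mult[symmetric] mult.commute)
    also have "\<dots> = (\<gamma> ^ (m * M)) powr (1 - \<eta>)"
      using gamma_pos by (simp add: powr_power powr_realpow[symmetric] powr_powr mult_ac)
    finally show "real b ^ m * mass_bound \<eta> m ^ M / real b ^ (Suc M * m) \<le> (\<gamma> ^ (m * M)) powr (1 - \<eta>)" by simp
  qed
qed

end

section \<open>Concentration of Theta\<close>

lemma first_power_le:
  fixes g t :: real
  assumes g: "0 < g" "g < 1" and t: "0 < t"
  obtains k where "g ^ k \<le> t" "\<And>j. j < k \<Longrightarrow> t < g ^ j"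
proof -
  obtain n where "g ^ n < t" using real_arch_pow_inv[OF t g(2)] by blast
  then have ex: "\<exists>k. g ^ k \<le> t" by (intro exI[of _ n]) simp
  show ?thesis
  proof (rule that)
    show "g ^ (LEAST k. g ^ k \<le> t) \<le> t" using ex by (rule LeastI_ex)
    show "t < g ^ j" if "j < (LEAST k. g ^ k \<le> t)" for j
      using not_less_Least[OF that] by simp
  qed
qed

context weierstrass
begin

lemma block_length:
  assumes \<epsilon>: "0 < \<epsilon>" and r: "0 < r" "r < 1"
  obtains m where "1 \<le> m" "\<gamma> ^ m \<le> r powr \<epsilon>" "\<gamma> * r powr \<epsilon> \<le> \<gamma> ^ m"
proof -
  have t: "0 < r powr \<epsilon>" "r powr \<epsilon> < 1" using r powr_less_mono2[OF \<epsilon>, of r 1] by simp_all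
  obtain m where m: "\<gamma> ^ m \<le> r powr \<epsilon>" "\<And>j. j < m \<Longrightarrow> r powr \<epsilon> < \<gamma> ^ j"
    using first_power_le[OF gamma_pos gamma_less_1 t(1)] by blast
  have "m \<noteq> 0" using m(1) t by (cases m) auto
  then obtain k where k: "m = Suc k" by (cases m) auto
  have "r powr \<epsilon> < \<gamma> ^ k" using m(2) k by simp
  then have "\<gamma> * r powr \<epsilon> \<le> \<gamma> * \<gamma> ^ k" using gamma_pos by (intro mult_left_mono) auto
  then show ?thesis using m(1) k by (intro that[of m]) auto
qed

lemma number_of_blocks:
  assumes m: "1 \<le> m" and \<rho>: "0 < \<rho>"
  obtains M where "M = 0 \<or> \<rho> \<le> \<gamma> ^ (Suc M * m)" "\<gamma> ^ (m * M) \<le> \<rho> / (\<gamma> ^ m)^2"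
proof -
  have g: "0 < \<gamma> ^ m" "\<gamma> ^ m < 1"
    using gamma_pos gamma_less_1 m by (auto simp: power_less_one_iff)
  obtain k where k: "(\<gamma> ^ m) ^ k \<le> \<rho>" "\<And>j. j < k \<Longrightarrow> \<rho> < (\<gamma> ^ m) ^ j"
    using first_power_le[OF g \<rho>] by blast
  show ?thesis
  \<comment> \<open>\<open>Suc M\<close> must stay below the first exponent \<open>k\<close> that
    reaches \<rho>, whence \<open>k - 2\<close>. Truncated subtraction gives \<open>M = 0\<close>
    for \<open>k < 2\<close>, and the two missing factors are the square in the bound.\<close>
  proof (rule that[of "k - 2"])
    show "k - 2 = 0 \<or> \<rho> \<le> \<gamma> ^ (Suc (k - 2) * m)"
    proof (cases "k - 2 = 0")
      case False
      then have "\<rho> < (\<gamma> ^ m) ^ Suc (k - 2)" by (intro k(2)) auto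
      then show ?thesis by (metis less_imp_le mult.commute power_mult)
    qed simp
    have "(\<gamma> ^ m) ^ (k - 2 + 2) \<le> (\<gamma> ^ m) ^ k" using g by (intro power_decreasing) auto
    then have "(\<gamma> ^ m) ^ (k - 2) * (\<gamma> ^ m)^2 \<le> \<rho>" using k(1) unfolding power_add by linarith
    then show "\<gamma> ^ (m * (k - 2)) \<le> \<rho> / (\<gamma> ^ m)^2" using g gamma_pos by (subst pos_le_divide_eq) (simp_all add: power_mult)
  qed
qed

definition Theta_band :: "real \<Rightarrow> (real \<Rightarrow> real) \<Rightarrow> real \<Rightarrow> (real \<times> real) set" where
  "Theta_band z a d = {p \<in> unit_square. a (snd p) \<le> Theta b \<gamma> z p \<and> Theta b \<gamma> z p \<le> a (snd p) + d}"

lemma snd_borel_measurable [measurable]: "snd \<in> borel_measurable (borel :: (real \<times> real) measure)"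
  unfolding borel_prod[symmetric] by measurable

lemma Theta_band_measurable [measurable]:
  assumes [measurable]: "a \<in> borel_measurable borel"
  shows "Theta_band z a d \<in> sets borel"
  unfolding Theta_band_def by measurable

text \<open>\<open>E\<close> precedes \<open>z\<close> and \<open>a\<close>, so it is uniform in
  both. The function \<open>a\<close> stands for a Borel version of the lower end points; closed
  bands give an upper estimate whichever end points belong to the intervals.\<close>

definition exceptional_set :: "real \<Rightarrow> real \<Rightarrow> real \<Rightarrow> real \<Rightarrow> (real \<times> real) set \<Rightarrow> bool" where
  "exceptional_set \<eta> \<delta> C r E \<longleftrightarrow> E \<in> sets borel \<and> E \<subseteq> unit_square \<and> emeasure lborel E \<le> ennreal (C * r powr \<delta>) \<and>
    (\<forall>z a. z \<noteq> 0 \<longrightarrow> \<bar>z\<bar> \<le> 1 \<longrightarrow> a \<in> borel_measurable borel \<longrightarrow>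
      emeasure lborel (Theta_band z a (2 * (r / \<bar>z\<bar>)) - E)
        \<le> ennreal (C * r powr (1 - 2 * \<eta>) * \<bar>z\<bar> powr (- (1 - \<eta>))))"

lemma Theta_concentration_borel:
  assumes \<eta>: "0 < \<eta>" "\<eta> \<le> 1"
  obtains \<delta> C where "0 < \<delta>" "\<delta> < \<eta>" "0 < C"
    "\<And>r. 0 < r \<Longrightarrow> r < 1 \<Longrightarrow> \<exists>E. exceptional_set \<eta> \<delta> C r E"
proof -
  \<comment> \<open>The loss \<open>1 / (\<gamma> ^ m)^2\<close> in the count will be of order
    \<open>r powr (- 2 * \<epsilon>)\<close>, so this \<epsilon> spends exactly the allowed extra
    factor \<open>r powr (- \<eta>)\<close>.\<close>
  define \<epsilon> where "\<epsilon> = \<eta> / 2"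
  define c where "c = 4 * approx_const + 2"
  have \<epsilon>: "0 < \<epsilon>" using \<eta> by (simp add: \<epsilon>_def)
  have "0 < c" using approx_const_pos by (simp add: c_def)
  then obtain C0 where C0: "0 < C0" "\<And>(m::nat) \<eta>. 1 \<le> m \<Longrightarrow>
    (\<Sum>u<b ^ m. emeasure lborel (crowded c \<eta> m u \<inter> {0..<1})) \<le> ennreal (real b ^ m * (C0 * (\<gamma> ^ m) powr \<eta>))"
    using crowded_measure_bound by blast
  \<comment> \<open>For \<open>M > 0\<close>, the chain \<open>r \<le> \<rho> \<le> \<gamma> ^ (Suc
    M * m) \<le> r powr (\<epsilon> * Suc M)\<close> forces
    \<open>Suc M \<le> 1 / \<epsilon>\<close>. Thus \<open>I\<close> bounds the relevant times for
    all \<open>r\<close> and \<open>z\<close>.\<close>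
  obtain I :: nat where I: "1 / \<epsilon> < real I" using reals_Archimedean2 by blast
  \<comment> \<open>The first summand pays for the union over times, the second for rounding the
    block length to an integer.\<close>
  define C where "C = real I * C0 + 1 / \<gamma>^2"
  have C: "0 < C" "real I * C0 \<le> C" "1 / \<gamma>^2 \<le> C" using C0 gamma_pos by (auto simp: C_def add_nonneg_pos)
  show ?thesis
  proof (rule that[of "\<epsilon> * \<eta>" C])
    show "0 < \<epsilon> * \<eta>" using \<eta> \<epsilon> by simp
    have "\<epsilon> * \<eta> \<le> \<epsilon> * 1" using \<eta> \<epsilon> by (intro mult_left_mono) auto
    also have "\<dots> < \<eta>" using \<eta> by (simp add: \<epsilon>_def)
    finally show "\<epsilon> * \<eta> < \<eta>" .
    show "0 < C" by (rule C)
    fix r :: real assume r: "0 < r" "r < 1"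
    obtain m where m: "1 \<le> m" "\<gamma> ^ m \<le> r powr \<epsilon>" "\<gamma> * r powr \<epsilon> \<le> \<gamma> ^ m"
      using block_length[OF \<epsilon> r] by blast
    define E where "E = (\<Union>i\<in>{1..I}. crowded_at c \<eta> m (i * m))"
    have [measurable]: "E \<in> sets borel" unfolding E_def by (intro sets.finite_UN) auto
    have "E \<subseteq> unit_square" by (auto simp: E_def crowded_at_def)
    moreover have "emeasure lborel E \<le> ennreal (C * r powr (\<epsilon> * \<eta>))"
    proof -
      have "emeasure lborel E \<le> (\<Sum>i\<in>{1..I}. emeasure lborel (crowded_at c \<eta> m (i * m)))"
        unfolding E_def by (intro emeasure_subadditive_finite) auto
      also have "\<dots> \<le> (\<Sum>i\<in>{1..I}. ennreal (C0 * (\<gamma> ^ m) powr \<eta>))"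
        using C0(1) by (intro sum_mono crowded_at_measure_bound C0(2) m(1)) auto
      also have "\<dots> = ennreal (real I * (C0 * (\<gamma> ^ m) powr \<eta>))"
        using C0(1) by (simp add: ennreal_of_nat_eq_real_of_nat flip: ennreal_mult)
      also have "\<dots> \<le> ennreal (C * r powr (\<epsilon> * \<eta>))"
      proof (rule ennreal_leI)
        have "(\<gamma> ^ m) powr \<eta> \<le> (r powr \<epsilon>) powr \<eta>" using m(2) gamma_pos \<eta> by (intro powr_mono2) auto
        then have "(real I * C0) * (\<gamma> ^ m) powr \<eta> \<le> C * r powr (\<epsilon> * \<eta>)"
          using C C0(1) by (intro mult_mono) (auto simp: powr_powr)
        then show "real I * (C0 * (\<gamma> ^ m) powr \<eta>) \<le> C * r powr (\<epsilon> * \<eta>)" by (simp add: mult.assoc)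
      qed
      finally show ?thesis .
    qed
    moreover have "emeasure lborel (Theta_band z a (2 * (r / \<bar>z\<bar>)) - E)
          \<le> ennreal (C * r powr (1 - 2 * \<eta>) * \<bar>z\<bar> powr (- (1 - \<eta>)))" (is "emeasure lborel ?A \<le> ennreal ?D")
      if z: "z \<noteq> 0" "\<bar>z\<bar> \<le> 1" and a [measurable]: "a \<in> borel_measurable borel" for z a
    proof -
      define \<rho> where "\<rho> = r / \<bar>z\<bar>"
      have \<rho>: "0 < \<rho>" "r \<le> \<rho>" using r z by (auto simp: \<rho>_def field_simps mult_left_le)
      obtain M where M: "M = 0 \<or> \<rho> \<le> \<gamma> ^ (Suc M * m)" "\<gamma> ^ (m * M) \<le> \<rho> / (\<gamma> ^ m)^2"
        using number_of_blocks[OF m(1) \<rho>(1)] by blast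
      have MI: "M \<le> I"
      proof (cases "M = 0")
        case False
        have "\<gamma> ^ (Suc M * m) = (\<gamma> ^ m) ^ Suc M" by (simp only: power_mult[symmetric] mult.commute)
        then have "r \<le> (\<gamma> ^ m) ^ Suc M" using M(1) \<rho>(2) False by linarith
        also have "\<dots> \<le> (r powr \<epsilon>) ^ Suc M" using m(2) gamma_pos by (intro power_mono) auto
        also have "\<dots> = r powr (\<epsilon> * real (Suc M))" using r by (subst powr_realpow[symmetric]) (auto simp: powr_powr)
        finally have "r powr 1 \<le> r powr (\<epsilon> * real (Suc M))" using r by simp
        then have "\<epsilon> * real (Suc M) \<le> 1" using r
          by (meson not_le powr_less_mono')
        then have "real (Suc M) \<le> 1 / \<epsilon>" using \<epsilon> by (simp add: field_simps)
        then have "real (Suc M) < real I" using I by linarith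
        then show ?thesis by simp
      qed simp
      have bound: "(\<gamma> ^ (m * M)) powr (1 - \<eta>) \<le> ?D"
      proof -
        have g2: "0 < (\<gamma> ^ m)^2" "(\<gamma> ^ m)^2 \<le> 1" using gamma_pos gamma_less_1 by (auto intro!: power_le_one)
        have "(\<gamma> ^ (m * M)) powr (1 - \<eta>) \<le> (\<rho> * (1 / (\<gamma> ^ m)^2)) powr (1 - \<eta>)"
          using M(2) \<eta> gamma_pos by (intro powr_mono2) auto
        also have "\<dots> = \<rho> powr (1 - \<eta>) * (1 / (\<gamma> ^ m)^2) powr (1 - \<eta>)"
          by (rule powr_mult)
        also have "\<dots> \<le> \<rho> powr (1 - \<eta>) * (1 / (\<gamma> ^ m)^2) powr 1"
          using g2 \<eta> by (intro mult_left_mono powr_mono) auto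
        also have "\<dots> = \<rho> powr (1 - \<eta>) * (1 / (\<gamma> ^ m)^2)" using g2 by simp
        also have "\<dots> \<le> \<rho> powr (1 - \<eta>) * (1 / (\<gamma> * r powr \<epsilon>)^2)"
          using m(3) gamma_pos r by (intro mult_left_mono divide_left_mono power_mono) auto
        also have "\<dots> = (r powr (1 - \<eta>) * \<bar>z\<bar> powr (- (1 - \<eta>))) * (1 / \<gamma>^2 * r powr (- \<eta>))"
        proof -
          have "\<rho> powr (1 - \<eta>) = r powr (1 - \<eta>) * \<bar>z\<bar> powr (- (1 - \<eta>))"
            unfolding \<rho>_def powr_minus_divide by (simp add: powr_divide)
          moreover have "(\<gamma> * r powr \<epsilon>)^2 = \<gamma>^2 * r powr \<eta>"
            using r by (simp add: power_mult_distrib power2_eq_square \<epsilon>_def flip: powr_add)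
          ultimately show ?thesis by (simp add: powr_minus divide_inverse)
        qed
        also have "\<dots> = 1 / \<gamma>^2 * (r powr (1 - \<eta>) * r powr (- \<eta>)) * \<bar>z\<bar> powr (- (1 - \<eta>))"
          by (simp only: mult_ac)
        also have "r powr (1 - \<eta>) * r powr (- \<eta>) = r powr (1 - 2 * \<eta>)" by (simp flip: powr_add)
        also have "1 / \<gamma>^2 * r powr (1 - 2 * \<eta>) * \<bar>z\<bar> powr (- (1 - \<eta>)) \<le> ?D" using C(3) by (intro mult_right_mono) auto
        finally show ?thesis .
      qed
      have A: "?A \<in> sets borel" by measurable
      have "emeasure lborel ?A = emeasure (lborel \<Otimes>\<^sub>M lborel) ?A" by (simp add: lborel_prod)
      \<comment> \<open>Slicing at fixed \<open>x\<close> fixes the interval of values and leaves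
        only the digits of \<xi> free.\<close>
      also have "\<dots> = (\<integral>\<^sup>+x. emeasure lborel ((\<lambda>\<xi>. (\<xi>, x)) -` ?A) \<partial>lborel)"
        using A by (intro lborel_pair.emeasure_pair_measure_alt2) (unfold lborel_prod, simp)
      also have "\<dots> \<le> (\<integral>\<^sup>+x. ennreal ?D * indicator {0..<1::real} x \<partial>lborel)"
      proof (rule nn_integral_mono)
        fix x :: real
        show "emeasure lborel ((\<lambda>\<xi>. (\<xi>, x)) -` ?A) \<le> ennreal ?D * indicator {0..<1} x"
        proof (cases "x \<in> {0..<1}")
          case False
          then have "(\<lambda>\<xi>. (\<xi>, x)) -` ?A = {}" by (auto simp: unit_square_def Theta_band_def)
          then show ?thesis by simp
        next
          case True
          have "emeasure lborel ((\<lambda>\<xi>. (\<xi>, x)) -` ?A) \<le> ennreal ((\<gamma> ^ (m * M)) powr (1 - \<eta>))"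
          proof (rule section_measure_bound[OF True z(2) m(1) c_def M(1)])
            show "(\<lambda>\<xi>. (\<xi>, x)) -` ?A \<subseteq> {0..<1}" by (auto simp: unit_square_def Theta_band_def)
            show "(\<xi>, x) \<notin> crowded_at c \<eta> m (i * m)"
              if "1 \<le> i" "i \<le> M" "\<xi> \<in> (\<lambda>\<xi>. (\<xi>, x)) -` ?A" for i \<xi>
              using that MI by (force simp: E_def)
            show "a x \<le> Theta b \<gamma> z (\<xi>, x) \<and> Theta b \<gamma> z (\<xi>, x) \<le> a x + 2 * \<rho>"
              if "\<xi> \<in> (\<lambda>\<xi>. (\<xi>, x)) -` ?A" for \<xi>
              using that by (auto simp: \<rho>_def Theta_band_def)
          qed
          also have "\<dots> \<le> ennreal ?D" by (intro ennreal_leI bound)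
          finally show ?thesis using True by simp
        qed
      qed
      also have "\<dots> = ennreal ?D" by (simp add: nn_integral_cmult_indicator)
      finally show ?thesis .
    qed
    ultimately have "exceptional_set \<eta> (\<epsilon> * \<eta>) C r E"
      using \<open>E \<in> sets borel\<close> by (auto simp: exceptional_set_def)
    then show "\<exists>E. exceptional_set \<eta> (\<epsilon> * \<eta>) C r E" ..
  qed
qed

text \<open>The graph lies in the band of every width, so \<open>r\<close> may tend to
  \<open>0\<close>. As \<open>E\<close> changes with \<open>r\<close>, its measure enters the bound
  too. The choice \<open>\<eta> = 1 / 4\<close> makes both exponents of \<open>r\<close>
  positive.\<close>

lemma Theta_graph_null:
  assumes z: "z \<noteq> 0" "\<bar>z\<bar> \<le> 1" and a [measurable]: "a \<in> borel_measurable borel"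
  shows "{p \<in> unit_square. Theta b \<gamma> z p = a (snd p)} \<in> null_sets lborel"
proof -
  let ?G = "{p \<in> unit_square. Theta b \<gamma> z p = a (snd p)}"
  have G: "?G \<in> sets borel" by measurable
  obtain \<delta> C where dC: "0 < \<delta>" "0 < C"
    "\<And>r. 0 < r \<Longrightarrow> r < 1 \<Longrightarrow> \<exists>E. exceptional_set (1/4) \<delta> C r E"
    by (rule Theta_concentration_borel[of "1/4"]) auto
  define f where "f r = C * r powr \<delta> + C * r powr (1/2) * \<bar>z\<bar> powr (- (3/4))" for r :: real
  have le: "emeasure lborel ?G \<le> ennreal (f r)" if r: "0 < r" "r < 1" for r
  proof -
    obtain E where E: "E \<in> sets borel" "emeasure lborel E \<le> ennreal (C * r powr \<delta>)"
        "emeasure lborel (Theta_band z a (2 * (r / \<bar>z\<bar>)) - E)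
          \<le> ennreal (C * r powr (1 - 2 * (1/4)) * \<bar>z\<bar> powr (- (1 - 1/4)))" (is "emeasure lborel ?A \<le> _")
      using dC(3)[OF r] z a unfolding exceptional_set_def by blast
    note [measurable] = E(1)
    have "?G \<subseteq> E \<union> ?A" using r by (auto simp: Theta_band_def)
    moreover have A: "?A \<in> sets borel" by measurable
    ultimately have "emeasure lborel ?G \<le> emeasure lborel (E \<union> ?A)"
      by (intro emeasure_mono) auto
    also have "\<dots> \<le> emeasure lborel E + emeasure lborel ?A"
      using A by (intro emeasure_subadditive) auto
    also have "\<dots> \<le> ennreal (C * r powr \<delta>) + ennreal (C * r powr (1 - 2 * (1/4)) * \<bar>z\<bar> powr (- (1 - 1/4)))"
      by (intro add_mono E)
    also have "\<dots> = ennreal (f r)" using dC(2) by (simp add: f_def flip: ennreal_plus)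
    finally show ?thesis .
  qed
  have powr0: "((\<lambda>r. r powr e) \<longlongrightarrow> 0) (at_right 0)" if "0 < e" for e :: real
    using eventually_mono[OF eventually_at_right_less[of "0::real"]] that
    by (intro tendsto_zero_powrI[where b = e]) (auto intro: less_imp_le)
  have "(f \<longlongrightarrow> C * 0 + C * 0 * \<bar>z\<bar> powr (- (3/4))) (at_right 0)"
    unfolding f_def by (intro tendsto_add tendsto_mult tendsto_const powr0) (use dC(1) in auto)
  then have "((\<lambda>r. ennreal (f r)) \<longlongrightarrow> 0) (at_right 0)" by (metis (no_types) tendsto_ennrealI ennreal_0 mult_zero_left mult_zero_right add_0)
  then have "emeasure lborel ?G \<le> 0"
    by (rule tendsto_lowerbound) (auto simp: eventually_at_right_field intro!: exI[of _ 1] le)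
  then show ?thesis using G by (auto simp: null_sets_def)
qed

end

section \<open>From Borel bands to measurable families of intervals\<close>

lemma interval_between_Inf_Sup:
  fixes I :: "real set"
  assumes "is_interval I" "bounded I" "I \<noteq> {}"
  shows "{Inf I<..<Sup I} \<subseteq> I" "I \<subseteq> {Inf I..Sup I}"
proof -
  have bdd: "bdd_above I" "bdd_below I"
    using assms(2) by (auto intro: bounded_imp_bdd_above bounded_imp_bdd_below)
  show "{Inf I<..<Sup I} \<subseteq> I"
  proof
    fix x assume "x \<in> {Inf I<..<Sup I}"
    then obtain y w where "y \<in> I" "y < x" "w \<in> I" "x < w"
      using cInf_less_iff[of I x] less_cSup_iff[of I x] assms(3) bdd by auto
    then show "x \<in> I" using assms(1) by (meson is_interval_1 less_imp_le)
  qed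
  show "I \<subseteq> {Inf I..Sup I}" using bdd by (auto intro: cInf_lower cSup_upper)
qed

lemma measurable_interval_family_borel_endpoint:
  assumes "measurable_interval_family L"
  obtains a N where "a \<in> borel_measurable borel" "N \<in> null_sets (lborel :: real measure)"
    "\<And>x. x \<in> {0..<1} - N \<Longrightarrow> a x = Inf (L x)"
proof -
  define g where "g x = indicator {0..<1} x *\<^sub>R Inf (L x)" for x :: real
  have "(\<lambda>x. Inf (L x)) \<in> borel_measurable (lebesgue_on {0..<1})"
    using assms by (simp add: measurable_interval_family_def)
  then have "g \<in> borel_measurable lebesgue"
    unfolding g_def by (subst (asm) borel_measurable_restrict_space_iff) auto
  then obtain a where a: "a \<in> borel_measurable lborel" "AE x in lborel. g x = a x"
    using completion_ex_borel_measurable_real by blast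
  from a(2) obtain N where N: "\<And>x. x \<in> space lborel - N \<Longrightarrow> g x = a x" "N \<in> null_sets lborel"
    using AE_E3 by blast
  show ?thesis
  proof (rule that[of a N])
    show "a x = Inf (L x)" if "x \<in> {0..<1} - N" for x
      using N(1)[of x] that by (simp add: g_def)
  qed (use a(1) N(2) in auto)
qed

text \<open>
  Which endpoints belong to \<open>L x\<close> may depend on \<open>x\<close> in a non-measurable way; this only matters
  on the graphs of the endpoint functions, which are null sets by \<open>Theta_graph_null\<close>.
\<close>

lemma (in weierstrass) Theta_interval_family_measure:
  assumes z: "z \<noteq> 0" "\<bar>z\<bar> \<le> 1" and E [measurable]: "E \<in> sets borel"
    and L: "measurable_interval_family L" and d: "\<And>x. x \<in> {0..<1} \<Longrightarrow> interval_length (L x) = d"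
    and bound: "\<And>a. a \<in> borel_measurable borel \<Longrightarrow>
      emeasure lborel (Theta_band z a d - E) \<le> ennreal D"
    and D: "0 \<le> D"
  shows "{(\<xi>, x) \<in> unit_square - E. Theta b \<gamma> z (\<xi>, x) \<in> L x} \<in> sets lebesgue \<and>
    measure lebesgue {(\<xi>, x) \<in> unit_square - E. Theta b \<gamma> z (\<xi>, x) \<in> L x} \<le> D" (is "?S \<in> _ \<and> _")
proof -
  obtain a N where a [measurable]: "a \<in> borel_measurable borel" and N: "N \<in> null_sets (lborel :: real measure)"
    and aN: "\<And>x. x \<in> {0..<1} - N \<Longrightarrow> a x = Inf (L x)"
    using measurable_interval_family_borel_endpoint[OF L] by blast
  have L_bounds: "{a x<..<a x + d} \<subseteq> L x" "L x \<subseteq> {a x..a x + d}" if x: "x \<in> {0..<1} - N" for x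
  proof -
    have "Sup (L x) = a x + d" using d[of x] aN[OF x] x by (simp add: interval_length_def)
    moreover have "is_interval (L x)" "bounded (L x)" "L x \<noteq> {}"
      using L x by (auto simp: measurable_interval_family_def)
    ultimately show "{a x<..<a x + d} \<subseteq> L x" "L x \<subseteq> {a x..a x + d}"
      using interval_between_Inf_Sup[of "L x"] aN[OF x] by auto
  qed
  \<comment> \<open>Off \<open>Z\<close>, which consists of the fibres where \<open>a\<close> may
    differ from the infimum and of the two boundary graphs, the set agrees with the open band.
    Completeness of Lebesgue measure then makes it measurable.\<close>
  define Z where "Z = (UNIV \<times> N) \<union> {p \<in> unit_square. Theta b \<gamma> z p = a (snd p)}
    \<union> {p \<in> unit_square. Theta b \<gamma> z p = a (snd p) + d}"
  let ?O = "{p \<in> unit_square - E. a (snd p) < Theta b \<gamma> z p \<and> Theta b \<gamma> z p < a (snd p) + d}"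
  let ?A = "Theta_band z a d - E"
  have "UNIV \<times> N \<in> null_sets (lborel :: (real \<times> real) measure)"
  proof -
    have "emeasure lborel ((UNIV :: real set) \<times> N) = emeasure lborel (UNIV :: real set) * emeasure lborel N"
      unfolding lborel_prod[symmetric] using N by (intro lborel.emeasure_pair_measure_Times) auto
    then show ?thesis using N by (auto simp: null_sets_def intro!: borel_Times)
  qed
  then have Z: "Z \<in> null_sets lborel"
    unfolding Z_def using Theta_graph_null[OF z, of a] Theta_graph_null[OF z, of "\<lambda>x. a x + d"]
    by (intro null_sets.Un) auto
  have O: "?O \<in> sets borel" and A: "?A \<in> sets borel" by measurable
  have sub: "?O - Z \<subseteq> ?S" "?S \<subseteq> ?O \<union> Z"
    using L_bounds by (fastforce simp: Z_def unit_square_def)+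
  have OA: "?O \<subseteq> ?A" by (auto simp: Theta_band_def)
  have "?S \<in> sets lebesgue"
  proof -
    have 1: "?S \<inter> Z \<in> sets lebesgue" using Z by (rule null_sets_completion) auto
    have 2: "?O - Z \<in> sets lebesgue" using O Z by auto
    have 3: "?S = (?O - Z) \<union> (?S \<inter> Z)" using sub by blast
    show ?thesis by (subst 3) (rule sets.Un[OF 2 1])
  qed
  moreover have "emeasure lebesgue ?S \<le> ennreal D"
  proof -
    have "emeasure lebesgue ?S \<le> emeasure lebesgue (?A \<union> Z)" using sub(2) OA A Z by (intro emeasure_mono) auto
    also have "\<dots> = emeasure lborel (?A \<union> Z)"
    proof -
      have "emeasure lebesgue B = emeasure lborel B" if "B \<in> sets lborel" for B :: "(real \<times> real) set"
        using that by simp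
      then show ?thesis by this (use A Z in auto)
    qed
    also have "\<dots> = emeasure lborel ?A" using A Z by (intro emeasure_Un_null_set) auto
    also have "\<dots> \<le> ennreal D" by (rule bound[OF a])
    finally show ?thesis .
  qed
  ultimately show ?thesis using D by (simp add: measure_def enn2real_leI)
qed

theorem proposition3p3:
  fixes b :: nat and lam \<gamma> :: real
  assumes "b \<ge> 2"
    and "lambda_b b < lam" and "lam < 1"
    and "\<gamma> = 1 / (real b * lam)"
  shows "\<forall>\<eta>::real. 0 < \<eta> \<and> \<eta> \<le> 1 \<longrightarrow>
    (\<exists>\<delta> C. 0 < \<delta> \<and> \<delta> < \<eta> \<and> 0 < C \<and>
      (\<forall>r. 0 < r \<and> r < 1 \<longrightarrow>
        (\<exists>E. E \<in> sets lebesgue \<and> E \<subseteq> unit_square \<and>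
          measure lebesgue E \<le> C * r powr \<delta> \<and>
          (\<forall>z L. z \<in> {-1..1} - {0} \<and> measurable_interval_family L \<and>
             (\<forall>x\<in>{0..<1}. interval_length (L x) = 2 * r / \<bar>z\<bar>) \<longrightarrow>
             {(\<xi>, x) \<in> unit_square - E. Theta b \<gamma> z (\<xi>, x) \<in> L x} \<in> sets lebesgue \<and>
             measure lebesgue {(\<xi>, x) \<in> unit_square - E. Theta b \<gamma> z (\<xi>, x) \<in> L x}
               \<le> C * r powr (1 - 2 * \<eta>) * \<bar>z\<bar> powr (- (1 - \<eta>))))))"
proof (intro allI impI)
  fix \<eta> :: real assume "0 < \<eta> \<and> \<eta> \<le> 1"
  then have \<eta>: "0 < \<eta>" "\<eta> \<le> 1" by auto
  interpret weierstrass b lam \<gamma> using assms by unfold_locales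
  obtain \<delta> C where dC: "0 < \<delta>" "\<delta> < \<eta>" "0 < C"
    "\<And>r. 0 < r \<Longrightarrow> r < 1 \<Longrightarrow> \<exists>E. exceptional_set \<eta> \<delta> C r E"
    using Theta_concentration_borel[OF \<eta>] by blast
  have concentration: "\<exists>E. E \<in> sets lebesgue \<and> E \<subseteq> unit_square \<and>
          measure lebesgue E \<le> C * r powr \<delta> \<and>
          (\<forall>z L. z \<in> {-1..1} - {0} \<and> measurable_interval_family L \<and>
             (\<forall>x\<in>{0..<1}. interval_length (L x) = 2 * r / \<bar>z\<bar>) \<longrightarrow>
             {(\<xi>, x) \<in> unit_square - E. Theta b \<gamma> z (\<xi>, x) \<in> L x} \<in> sets lebesgue \<and>
             measure lebesgue {(\<xi>, x) \<in> unit_square - E. Theta b \<gamma> z (\<xi>, x) \<in> L x}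
               \<le> C * r powr (1 - 2 * \<eta>) * \<bar>z\<bar> powr (- (1 - \<eta>)))"
    if r: "0 < r" "r < 1" for r
  proof -
    obtain E where E: "E \<in> sets borel" "E \<subseteq> unit_square" "emeasure lborel E \<le> ennreal (C * r powr \<delta>)"
      and main: "\<And>z a. z \<noteq> 0 \<Longrightarrow> \<bar>z\<bar> \<le> 1 \<Longrightarrow> a \<in> borel_measurable borel \<Longrightarrow>
        emeasure lborel (Theta_band z a (2 * (r / \<bar>z\<bar>)) - E)
          \<le> ennreal (C * r powr (1 - 2 * \<eta>) * \<bar>z\<bar> powr (- (1 - \<eta>)))"
      using dC(4)[OF r] unfolding exceptional_set_def by blast
    note [measurable] = E(1)
    have "measure lebesgue E \<le> C * r powr \<delta>"
      using E(1,3) dC(3) by (simp add: measure_def enn2real_leI)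
    moreover have "{(\<xi>, x) \<in> unit_square - E. Theta b \<gamma> z (\<xi>, x) \<in> L x} \<in> sets lebesgue \<and>
        measure lebesgue {(\<xi>, x) \<in> unit_square - E. Theta b \<gamma> z (\<xi>, x) \<in> L x}
          \<le> C * r powr (1 - 2 * \<eta>) * \<bar>z\<bar> powr (- (1 - \<eta>))"
      if "z \<in> {-1..1} - {0}" "measurable_interval_family L"
        "\<forall>x\<in>{0..<1}. interval_length (L x) = 2 * r / \<bar>z\<bar>" for z L
      using that dC(3) main[of z]
      by (intro Theta_interval_family_measure[where d = "2 * (r / \<bar>z\<bar>)"] E(1)) auto
    ultimately show ?thesis using E(1,2) by (intro exI[of _ E]) auto
  qed
  then show "\<exists>\<delta> C. 0 < \<delta> \<and> \<delta> < \<eta> \<and> 0 < C \<and>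
      (\<forall>r. 0 < r \<and> r < 1 \<longrightarrow>
        (\<exists>E. E \<in> sets lebesgue \<and> E \<subseteq> unit_square \<and>
          measure lebesgue E \<le> C * r powr \<delta> \<and>
          (\<forall>z L. z \<in> {-1..1} - {0} \<and> measurable_interval_family L \<and>
             (\<forall>x\<in>{0..<1}. interval_length (L x) = 2 * r / \<bar>z\<bar>) \<longrightarrow>
             {(\<xi>, x) \<in> unit_square - E. Theta b \<gamma> z (\<xi>, x) \<in> L x} \<in> sets lebesgue \<and>
             measure lebesgue {(\<xi>, x) \<in> unit_square - E. Theta b \<gamma> z (\<xi>, x) \<in> L x}
               \<le> C * r powr (1 - 2 * \<eta>) * \<bar>z\<bar> powr (- (1 - \<eta>)))))"
    using dC(1-3) by blast
qed

end
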